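(* Let $\mathcal{K}^{\langle 0\rangle}$ be a simple nested fractal in $\mathbb{R}^2$ whose number $k\ge 3$ of essential fixed points is odd, and let $\mathcal{K}^{\langle\infty\rangle}$ be the corresponding unbounded simple nested fractal. The following conditions are equivalent. (A) $\mathcal{K}^{\langle\infty\rangle}$ has the good labelling property (GLP). (B) Every cycle of $0$-complexes in $\mathcal{K}^{\langle 1\rangle}$, consisting of $c$ rotations by the angle $\frac{k+1}{k}\pi$ and $d$ rotations by the angle $\frac{k-1}{k}\pi$, satisfies $k\mid (c-d)$.
   Context: Simple nested fractal (SNF). Let $\Psi_i:\mathbb{R}^2\to\mathbb{R}^2$, $\Psi_i(x)=x/L+\nu_i$, $i=1,\dots,N$, with $L>1$, $\nu_i\in\mathbb{R}^2$, and one of the $\nu_i$ equal to $0$. $\mathcal{K}^{\langle 0\rangle}$ is the unique nonempty compact set with $\mathcal{K}^{\langle 0\rangle}=\bigcup_{i=1}^N\Psi_i(\mathcal{K}^{\langle 0\rangle})$. Let $F$ be the set of fixed points of the $\Psi_i$. A point $x\in F$ is an essential fixed point if there are another fixed point $y\in F$ and two different maps $\Psi_i,\Psi_j$ with $\Psi_i(x)=\Psi_j(y)$. $V_0^{\langle 0\rangle}$ is the set of essential fixed points and $k=\#V_0^{\langle 0\rangle}$. $\mathcal{K}^{\langle 0\rangle}$ is an SNF if: (1) $k\ge 2$; (2) (Open Set Condition) there is an open $U\subset\mathbb{R}^2$ with $\Psi_i(U)\cap\Psi_j(U)=\emptyset$ for $i\ne j$ and $\bigcup_i\Psi_i(U)\subseteq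 U$; (3) (Nesting) $\Psi_i(\mathcal{K}^{\langle 0\rangle})\cap\Psi_j(\mathcal{K}^{\langle 0\rangle})=\Psi_i(V_0^{\langle 0\rangle})\cap\Psi_j(V_0^{\langle 0\rangle})$ for $i\neq j$; (4) (Symmetry) for $x,y\in V_0^{\langle 0\rangle}$ let $S_{x,y}$ be the reflection in the line perpendicularly bisecting $[x,y]$; for all $i\in\{1,\dots,N\}$ and all $x,y\in V_0^{\langle 0\rangle}$ there is $j\in\{1,\dots,N\}$ with $S_{x,y}(\Psi_i(V_0^{\langle 0\rangle}))=\Psi_j(V_0^{\langle 0\rangle})$; (5) (Connectivity) the graph on $V_{-1}^{\langle 0\rangle}=\bigcup_i\Psi_i(V_0^{\langle 0\rangle})$ in which $x,y$ are joined iff $x,y\in\Psi_i(\mathcal{K}^{\langle 0\rangle})$ for some $i$ is connected. Throughout $k\ge 3$; it is known that $V_0^{\langle 0\rangle}$ is then the vertex set of a regular $k$-gon. Complexes. $\mathcal{K}^{\langle M\rangle}=L^M\mathcal{K}^{\langle 0\rangle}$ and $\mathcal{K}^{\langle\infty\rangle}=\bigcup_{M\ge 0}\mathcal{K}^{\langle M\rangle}$ (the unbounded SNF). A $0$-complex is a set $\Delta_0=\mathcal{K}^{\langle 0\rangle}+\nu_{\Delta_0}\subset\mathcal{K}^{\langle\infty\rangle}$ with $\nu_{\Delta_0}=\sum_{j=1}^{J}L^j\nu_{i_j}$, $J\ge 1$, $\nu_{i_j}\in\{\nu_1,\dots,\nu_N\}$; its vertex set is $V(\Delta_0)=V_0^{\langle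 0\rangle}+\nu_{\Delta_0}$. The $0$-complexes in $\mathcal{K}^{\langle 1\rangle}$ are the sets $\mathcal{K}^{\langle 0\rangle}+L\nu_i$, $i=1,\dots,N$. $V_0^{\langle\infty\rangle}$ is the set of vertices of all $0$-complexes. Two distinct $0$-complexes are adjacent if they intersect (necessarily in a common vertex). GLP. Let $\mathcal{A}$ be a set of $k$ labels, and let $\mathcal{R}_0$ be the set of the $k$ rotations around the barycenter of $\mathcal{K}^{\langle 0\rangle}$ mapping $V_0^{\langle 0\rangle}$ onto itself. $\mathcal{K}^{\langle\infty\rangle}$ has the GLP if there is $\ell:V_0^{\langle\infty\rangle}\to\mathcal{A}$ whose restriction to $V_0^{\langle 0\rangle}$ is a bijection onto $\mathcal{A}$ and such that for every $0$-complex $\Delta_0=\mathcal{K}^{\langle 0\rangle}+\nu_{\Delta_0}$ there is $R_{\Delta_0}\in\mathcal{R}_0$ with $\ell(v)=\ell(R_{\Delta_0}(v-\nu_{\Delta_0}))$ for all $v\in V(\Delta_0)$. (By self-similarity the analogous property for complexes of any other scale $L^M$, $M\in\mathbb{Z}$, is equivalent.) Cycles and rotations. A cycle of $0$-complexes in $\mathcal{K}^{\langle 1\rangle}$ is a sequence $\Delta_{0,1},\dots,\Delta_{0,j}$ of distinct $0$-complexes in $\mathcal{K}^{\langle 1\rangle}$ such that consecutive ones are adjacent and $\Delta_{0,j}$ is adjacent to $\Delta_{0,1}$. A rotation by angle $\alpha$ (counter-clockwise) occurs in the cycle each time the next complex (the step from $\Delta_{0,j}$ to $\Delta_{0,1}$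 included) arises from the previous one by rotation by $\alpha$ around their common vertex, i.e. this rotation maps the regular $k$-gon spanned by the vertices of the previous complex onto that of the next. For odd $k$ it is known that only the angles $\frac{k+1}{k}\pi$ and $\frac{k-1}{k}\pi$ can occur. *)

theory Defs
  imports "HOL-Analysis.Analysis"
begin

text \<open>
  The plane is modelled by the type \<^typ>\<open>complex\<close>. An iterated function system is given by
  the scaling factor \<open>L\<close>, the number \<open>N\<close> of maps and the translation vectors \<open>\<nu> 1, \<dots>, \<nu> N\<close>;
  other values of \<open>\<nu>\<close> are irrelevant. The parameter \<open>K\<close> stands for the set
  \<open>\<K>\<^sup>0\<close>, characterised by \<open>is_attractor\<close> below.
\<close>

definition ifs_map :: "real \<Rightarrow> (nat \<Rightarrow> complex) \<Rightarrow> nat \<Rightarrow> complex \<Rightarrow> complex" where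
  "ifs_map L \<nu> i x = x /\<^sub>R L + \<nu> i"

text \<open>For \<open>L > 1\<close> and \<open>N \<ge> 1\<close> exactly one set has this property (Hutchinson).\<close>

definition is_attractor :: "real \<Rightarrow> nat \<Rightarrow> (nat \<Rightarrow> complex) \<Rightarrow> complex set \<Rightarrow> bool" where
  "is_attractor L N \<nu> K \<longleftrightarrow>
     K \<noteq> {} \<and> compact K \<and> K = (\<Union>i\<in>{1..N}. ifs_map L \<nu> i ` K)"

definition fixed_points :: "real \<Rightarrow> nat \<Rightarrow> (nat \<Rightarrow> complex) \<Rightarrow> complex set" where
  "fixed_points L N \<nu> = {x. \<exists>i\<in>{1..N}. ifs_map L \<nu> i x = x}"

definition essential_fixed_points :: "real \<Rightarrow> nat \<Rightarrow> (nat \<Rightarrow> complex) \<Rightarrow> complex set" where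
  "essential_fixed_points L N \<nu> =
     {x \<in> fixed_points L N \<nu>. \<exists>y\<in>fixed_points L N \<nu>. y \<noteq> x \<and>
        (\<exists>i\<in>{1..N}. \<exists>j\<in>{1..N}. ifs_map L \<nu> i \<noteq> ifs_map L \<nu> j \<and>
           ifs_map L \<nu> i x = ifs_map L \<nu> j y)}"

text \<open>The open set must be required to be nonempty: the empty set satisfies the rest trivially.\<close>

definition open_set_condition :: "real \<Rightarrow> nat \<Rightarrow> (nat \<Rightarrow> complex) \<Rightarrow> bool" where
  "open_set_condition L N \<nu> \<longleftrightarrow>
     (\<exists>U. open U \<and> U \<noteq> {} \<and>
        (\<forall>i\<in>{1..N}. \<forall>j\<in>{1..N}. i \<noteq> j \<longrightarrow> ifs_map L \<nu> i ` U \<inter> ifs_map L \<nu> j ` U = {}) \<and>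
        (\<Union>i\<in>{1..N}. ifs_map L \<nu> i ` U) \<subseteq> U)"

definition nesting :: "real \<Rightarrow> nat \<Rightarrow> (nat \<Rightarrow> complex) \<Rightarrow> complex set \<Rightarrow> bool" where
  "nesting L N \<nu> K \<longleftrightarrow>
     (\<forall>i\<in>{1..N}. \<forall>j\<in>{1..N}. i \<noteq> j \<longrightarrow>
        ifs_map L \<nu> i ` K \<inter> ifs_map L \<nu> j ` K =
        ifs_map L \<nu> i ` essential_fixed_points L N \<nu> \<inter>
        ifs_map L \<nu> j ` essential_fixed_points L N \<nu>)"

text \<open>Reflection in the perpendicular bisector of the segment from \<open>x\<close> to \<open>y\<close>, for \<open>x \<noteq> y\<close>.\<close>

definition bisector_reflection :: "complex \<Rightarrow> complex \<Rightarrow> complex \<Rightarrow> complex" where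
  "bisector_reflection x y z =
     z - (2 * ((z - midpoint x y) \<bullet> (y - x)) / (norm (y - x))\<^sup>2) *\<^sub>R (y - x)"

definition symmetry_condition :: "real \<Rightarrow> nat \<Rightarrow> (nat \<Rightarrow> complex) \<Rightarrow> bool" where
  "symmetry_condition L N \<nu> \<longleftrightarrow>
     (let V = essential_fixed_points L N \<nu> in
      \<forall>i\<in>{1..N}. \<forall>x\<in>V. \<forall>y\<in>V. x \<noteq> y \<longrightarrow>
        (\<exists>j\<in>{1..N}. bisector_reflection x y ` ifs_map L \<nu> i ` V = ifs_map L \<nu> j ` V))"

definition connectivity_condition :: "real \<Rightarrow> nat \<Rightarrow> (nat \<Rightarrow> complex) \<Rightarrow> complex set \<Rightarrow> bool" where
  "connectivity_condition L N \<nu> K \<longleftrightarrow>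
     (let W = (\<Union>i\<in>{1..N}. ifs_map L \<nu> i ` essential_fixed_points L N \<nu>);
          E = {(x, y). x \<in> W \<and> y \<in> W \<and>
                 (\<exists>i\<in>{1..N}. x \<in> ifs_map L \<nu> i ` K \<and> y \<in> ifs_map L \<nu> i ` K)}
      in \<forall>x\<in>W. \<forall>y\<in>W. (x, y) \<in> E\<^sup>*)"

definition simple_nested_fractal ::
    "real \<Rightarrow> nat \<Rightarrow> (nat \<Rightarrow> complex) \<Rightarrow> complex set \<Rightarrow> bool" where
  "simple_nested_fractal L N \<nu> K \<longleftrightarrow>
     L > 1 \<and> (\<exists>i\<in>{1..N}. \<nu> i = 0) \<and> is_attractor L N \<nu> K \<and>
     card (essential_fixed_points L N \<nu>) \<ge> 2 \<and>
     open_set_condition L N \<nu> \<and>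
     nesting L N \<nu> K \<and>
     symmetry_condition L N \<nu> \<and>
     connectivity_condition L N \<nu> K"

definition unbounded_fractal :: "real \<Rightarrow> complex set \<Rightarrow> complex set" where
  "unbounded_fractal L K = (\<Union>M::nat. (\<lambda>x. L ^ M *\<^sub>R x) ` K)"

definition complex_shifts :: "real \<Rightarrow> nat \<Rightarrow> (nat \<Rightarrow> complex) \<Rightarrow> complex set \<Rightarrow> complex set" where
  "complex_shifts L N \<nu> K =
     {s. (\<exists>J\<ge>1. \<exists>i :: nat \<Rightarrow> nat. (\<forall>j\<in>{1..J}. i j \<in> {1..N}) \<and>
            s = (\<Sum>j=1..J. L ^ j *\<^sub>R \<nu> (i j))) \<and>
         (+) s ` K \<subseteq> unbounded_fractal L K}"

definition zero_complexes ::
    "real \<Rightarrow> nat \<Rightarrow> (nat \<Rightarrow> complex) \<Rightarrow> complex set \<Rightarrow> complex set set" where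
  "zero_complexes L N \<nu> K = (\<lambda>s. (+) s ` K) ` complex_shifts L N \<nu> K"

text \<open>A translate of a nonempty compact set determines the translation vector, so a
  \<open>0\<close>-complex has only one shift.\<close>

lemma translate_compact_inj:
  fixes K :: "complex set"
  assumes "compact K" "K \<noteq> {}" "(+) s ` K = (+) t ` K"
  shows "s = t"
proof -
  have "continuous_on K (\<lambda>z. z \<bullet> (s - t))"
    by (intro continuous_intros)
  then obtain x where x: "x \<in> K" "\<And>y. y \<in> K \<Longrightarrow> y \<bullet> (s - t) \<le> x \<bullet> (s - t)"
    using continuous_attains_sup[OF assms(1,2)] by blast
  have "s + x \<in> (+) t ` K"
    using x(1) assms(3) by blast
  then obtain y where y: "y \<in> K" "s + x = t + y"
    by blast
  have "y = x + (s - t)"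
    using y(2) by (simp add: algebra_simps)
  then have "(s - t) \<bullet> (s - t) \<le> 0"
    using x(2)[OF y(1)] by (simp add: inner_add_left)
  then show ?thesis
    using inner_gt_zero_iff[of "s - t"] by (metis eq_iff_diff_eq_0 not_le)
qed

definition complex_vertices ::
    "real \<Rightarrow> nat \<Rightarrow> (nat \<Rightarrow> complex) \<Rightarrow> complex set \<Rightarrow> complex set \<Rightarrow> complex set" where
  "complex_vertices L N \<nu> K \<Delta> =
     (\<Union>s\<in>{s \<in> complex_shifts L N \<nu> K. \<Delta> = (+) s ` K}. (+) s ` essential_fixed_points L N \<nu>)"

definition all_vertices :: "real \<Rightarrow> nat \<Rightarrow> (nat \<Rightarrow> complex) \<Rightarrow> complex set \<Rightarrow> complex set" where
  "all_vertices L N \<nu> K = (\<Union>\<Delta>\<in>zero_complexes L N \<nu> K. complex_vertices L N \<nu> K \<Delta>)"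

text \<open>Counter-clockwise rotation by the angle \<open>\<alpha>\<close> around the point \<open>p\<close>.\<close>

definition rotation :: "complex \<Rightarrow> real \<Rightarrow> complex \<Rightarrow> complex" where
  "rotation p \<alpha> z = p + cis \<alpha> * (z - p)"

text \<open>The barycenter is the centroid of the vertices, i.e. the centre of the regular polygon
  they form. It is the only point around which a nontrivial rotation can preserve the finite
  vertex set.\<close>

definition barycenter :: "real \<Rightarrow> nat \<Rightarrow> (nat \<Rightarrow> complex) \<Rightarrow> complex" where
  "barycenter L N \<nu> =
     (\<Sum>v\<in>essential_fixed_points L N \<nu>. v) /\<^sub>R real (card (essential_fixed_points L N \<nu>))"

definition vertex_rotations ::
    "real \<Rightarrow> nat \<Rightarrow> (nat \<Rightarrow> complex) \<Rightarrow> (complex \<Rightarrow> complex) set" where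
  "vertex_rotations L N \<nu> =
     {R. (\<exists>\<alpha>. R = rotation (barycenter L N \<nu>) \<alpha>) \<and>
         R ` essential_fixed_points L N \<nu> = essential_fixed_points L N \<nu>}"

definition good_labelling_property ::
    "real \<Rightarrow> nat \<Rightarrow> (nat \<Rightarrow> complex) \<Rightarrow> complex set \<Rightarrow> 'a set \<Rightarrow> bool" where
  "good_labelling_property L N \<nu> K A \<longleftrightarrow>
     (\<exists>l :: complex \<Rightarrow> 'a.
        l ` all_vertices L N \<nu> K \<subseteq> A \<and>
        bij_betw l (essential_fixed_points L N \<nu>) A \<and>
        (\<forall>s\<in>complex_shifts L N \<nu> K. \<exists>R\<in>vertex_rotations L N \<nu>.
           \<forall>v\<in>complex_vertices L N \<nu> K ((+) s ` K). l v = l (R (v - s))))"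

definition unit_complexes ::
    "real \<Rightarrow> nat \<Rightarrow> (nat \<Rightarrow> complex) \<Rightarrow> complex set \<Rightarrow> complex set set" where
  "unit_complexes L N \<nu> K = {(+) (L *\<^sub>R \<nu> i) ` K | i. i \<in> {1..N}}"

definition adjacent :: "complex set \<Rightarrow> complex set \<Rightarrow> bool" where
  "adjacent \<Delta> \<Delta>' \<longleftrightarrow> \<Delta> \<noteq> \<Delta>' \<and> \<Delta> \<inter> \<Delta>' \<noteq> {}"

text \<open>The successor of position \<open>i\<close> is taken modulo the length of the list, so the closing step
  from the last complex back to the first one is included.\<close>

definition is_cycle ::
    "real \<Rightarrow> nat \<Rightarrow> (nat \<Rightarrow> complex) \<Rightarrow> complex set \<Rightarrow> complex set list \<Rightarrow> bool" where
  "is_cycle L N \<nu> K \<Delta>s \<longleftrightarrow>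
     \<Delta>s \<noteq> [] \<and> distinct \<Delta>s \<and> set \<Delta>s \<subseteq> unit_complexes L N \<nu> K \<and>
     (\<forall>i<length \<Delta>s. adjacent (\<Delta>s ! i) (\<Delta>s ! (Suc i mod length \<Delta>s)))"

definition arises_by_rotation ::
    "real \<Rightarrow> nat \<Rightarrow> (nat \<Rightarrow> complex) \<Rightarrow> complex set \<Rightarrow> real \<Rightarrow> complex set \<Rightarrow> complex set \<Rightarrow> bool" where
  "arises_by_rotation L N \<nu> K \<alpha> \<Delta> \<Delta>' \<longleftrightarrow>
     (\<exists>p \<in> complex_vertices L N \<nu> K \<Delta> \<inter> complex_vertices L N \<nu> K \<Delta>'.
        rotation p \<alpha> ` (convex hull complex_vertices L N \<nu> K \<Delta>) =
        convex hull complex_vertices L N \<nu> K \<Delta>')"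

definition rotation_count ::
    "real \<Rightarrow> nat \<Rightarrow> (nat \<Rightarrow> complex) \<Rightarrow> complex set \<Rightarrow> real \<Rightarrow> complex set list \<Rightarrow> nat" where
  "rotation_count L N \<nu> K \<alpha> \<Delta>s =
     card {i. i < length \<Delta>s \<and>
       arises_by_rotation L N \<nu> K \<alpha> (\<Delta>s ! i) (\<Delta>s ! (Suc i mod length \<Delta>s))}"

end

theory Submission imports Defs begin

text \<open>
  Write the vertices as \<open>b + \<xi>\<close> with \<open>\<xi> \<in> X\<close>, where \<open>b\<close> is the barycenter. The reflections in the
  symmetry condition fix \<open>b\<close>, so that \<open>X\<close> is closed under \<open>\<xi> * \<eta> / \<zeta>\<close> and is a coset of
  the group of \<open>k\<close>-th roots of unity. If two cells \<open>i\<close>, \<open>j\<close> meet in the vertex given by \<open>\<xi>\<close> in the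
  first and \<open>\<xi>'\<close> in the second, then the second arises from the first by the rotation
  with factor \<open>\<xi>' / \<xi>\<close>; for odd \<open>k\<close> this factor is \<open>\<tau> = cis ((k + 1) / k * pi)\<close> or its inverse, and
  \<open>\<tau>\<close> is a primitive \<open>k\<close>-th root of unity. So the condition on cycles says that the product of these
  factors along every cycle is 1.

  A labelling rotates the cell \<open>i\<close> by a factor \<open>g i\<close> with \<open>g i * \<xi> = g j * \<xi>'\<close>, which forces the product
  along a cycle to be 1. Conversely, if all these products are 1 then such a potential \<open>g\<close> exists.
  The rotation of the fractal by \<open>\<omega> = cis (2 * pi / k)\<close> multiplies \<open>g\<close> by some \<open>\<omega> ^ \<delta>\<close>. With
  \<open>m = Suc \<delta>\<close>, rotating the complex with shift \<open>\<Sum>j=1..J. L ^ j *\<^sub>R \<nu> (w j)\<close> by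
  \<open>\<Prod>j=1..J. g (w j) ^ m ^ (j - 1)\<close> gives a consistent labelling of all vertices.
\<close>

section \<open>Perpendicular bisector reflections in complex form\<close>

text \<open>Twice the inner product is \<open>w * cnj e + cnj w * e\<close> with
  \<open>w = z - m\<close>; its first summand cancels \<open>w\<close>, so that only a conjugation
  with a unimodular factor remains.\<close>

lemma bisector_reflection_eq:
  assumes "x \<noteq> y"
  shows "bisector_reflection x y z = x + (x - y) / cnj (y - x) * cnj (z - y)"
proof -
  define e where "e = y - x"
  define m where "m = midpoint x y"
  have e: "e \<noteq> 0" "cnj e \<noteq> 0" using assms by (auto simp: e_def)
  have m: "m = x + e / 2" "y = x + e"
    by (auto simp: m_def e_def midpoint_def scaleR_conv_of_real field_simps)
  have "complex_of_real (2 * ((z - m) \<bullet> e)) = (z - m) * cnj e + cnj (z - m) * e"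
    by (simp add: complex_eq_iff inner_complex_def algebra_simps)
  then have "complex_of_real (2 * ((z - m) \<bullet> e) / (norm e)\<^sup>2) = ((z - m) * cnj e + cnj (z - m) * e) / (e * cnj e)"
    by (simp add: complex_norm_square del: of_real_mult flip: of_real_power)
  then have "bisector_reflection x y z = z - ((z - m) * cnj e + cnj (z - m) * e) / (e * cnj e) * e"
    by (simp add: bisector_reflection_def m_def e_def scaleR_conv_of_real)
  also have "\<dots> = m - e / cnj e * cnj (z - m)"
    using e by (simp add: field_simps)
  also have "\<dots> = x + (- e) / cnj e * cnj (z - y)"
    using e by (simp add: m field_simps)
  finally show ?thesis by (simp add: e_def)
qed

lemma norm_minus_divide_cnj: "x \<noteq> y \<Longrightarrow> norm ((x - y) / cnj (y - x)) = 1"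
  by (simp only: norm_divide complex_mod_cnj norm_minus_commute[of y x]) simp

text \<open>The factor in the conjugation form has modulus 1, so taking norms in the fixed point
  equation suffices.\<close>

lemma bisector_reflection_fixes_imp_dist_eq:
  assumes "bisector_reflection x y c = c"
  shows "dist x c = dist y c"
proof (cases "x = y")
  case False
  have "c - x = (x - y) / cnj (y - x) * cnj (c - y)"
    using assms bisector_reflection_eq[OF False, of c] by (simp add: algebra_simps)
  then have "norm (c - x) = norm (cnj (c - y))"
    using norm_minus_divide_cnj[OF False] by (simp only: norm_mult mult_1)
  then show ?thesis by (simp add: dist_norm norm_minus_commute del: complex_cnj_diff)
qed auto

section \<open>Cells, attractor and fixed points\<close>

locale nested_fractal =
  fixes L :: real and N k :: nat and \<nu> :: "nat \<Rightarrow> complex" and K :: "complex set"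
  assumes snf: "simple_nested_fractal L N \<nu> K"
    and k_eq: "k = card (essential_fixed_points L N \<nu>)"
    and k_ge: "k \<ge> 3"
begin

abbreviation \<psi> :: "nat \<Rightarrow> complex \<Rightarrow> complex" where "\<psi> \<equiv> ifs_map L \<nu>"
abbreviation V :: "complex set" where "V \<equiv> essential_fixed_points L N \<nu>"
abbreviation b :: complex where "b \<equiv> barycenter L N \<nu>"
definition X :: "complex set" where "X = {\<xi>. b + \<xi> \<in> V}"

lemma L_gt: "L > 1"
  and ex_zero: "\<exists>i\<in>{1..N}. \<nu> i = 0"
  and attractor: "is_attractor L N \<nu> K"
  and osc: "open_set_condition L N \<nu>"
  and nest: "nesting L N \<nu> K"
  and symm: "symmetry_condition L N \<nu>"
  and conn: "connectivity_condition L N \<nu> K"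
  using snf by (auto simp: simple_nested_fractal_def)

lemma K_nonempty: "K \<noteq> {}" and K_compact: "compact K"
  and K_eq: "K = (\<Union>i\<in>{1..N}. \<psi> i ` K)"
  using attractor by (auto simp: is_attractor_def)

lemma \<psi>_K: "i \<in> {1..N} \<Longrightarrow> z \<in> K \<Longrightarrow> \<psi> i z \<in> K"
  using K_eq by blast

lemma K_cases:
  assumes "z \<in> K"
  obtains i z' where "i \<in> {1..N}" "z' \<in> K" "z = \<psi> i z'"
  using K_eq assms by blast

lemma \<psi>_eq: "\<psi> i z = z / of_real L + \<nu> i"
  by (simp add: ifs_map_def scaleR_conv_of_real field_simps)

lemma L_nonzero [simp]: "L \<noteq> 0"
  using L_gt by auto

lemma \<psi>_eq_iff [simp]: "\<psi> i z = \<psi> i w \<longleftrightarrow> z = w"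
  using L_gt by (simp add: \<psi>_eq)

text \<open>Equal translations give equal maps, whose images of the nonempty open set could not be
  disjoint.\<close>

lemma \<nu>_inj: "inj_on \<nu> {1..N}"
proof (rule inj_onI)
  fix i j assume ij: "i \<in> {1..N}" "j \<in> {1..N}" "\<nu> i = \<nu> j"
  obtain U where "U \<noteq> {}" and
    "\<forall>i\<in>{1..N}. \<forall>j\<in>{1..N}. i \<noteq> j \<longrightarrow> \<psi> i ` U \<inter> \<psi> j ` U = {}"
    using osc by (auto simp: open_set_condition_def)
  moreover have "\<psi> i = \<psi> j" using ij by (auto simp: ifs_map_def)
  ultimately show "i = j" using ij by force
qed

lemma \<psi>_index_eq: "i \<in> {1..N} \<Longrightarrow> j \<in> {1..N} \<Longrightarrow> \<psi> i z = \<psi> j z \<Longrightarrow> i = j"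
  using \<nu>_inj by (auto simp: \<psi>_eq dest: inj_onD)

lemma finite_V: "finite V"
  using k_eq k_ge by (metis card.infinite not_numeral_le_zero)

text \<open>The contraction moves a nearest point of \<open>K\<close> closer to its fixed point
  \<open>x\<close> while staying in \<open>K\<close>, so the distance is 0.\<close>

lemma fixed_point_in_K:
  assumes "i \<in> {1..N}" "\<psi> i x = x"
  shows "x \<in> K"
proof -
  obtain z where z: "z \<in> K" "\<And>y. y \<in> K \<Longrightarrow> dist x z \<le> dist x y"
    using distance_attains_inf[OF compact_imp_closed[OF K_compact] K_nonempty, of x] by blast
  have "dist x (\<psi> i z) = dist (\<psi> i x) (\<psi> i z)" using assms by simp
  also have "\<dots> = dist x z / L"
    using L_gt by (simp add: ifs_map_def dist_norm scaleR_diff_right[symmetric] divide_inverse_commute)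
  finally have "dist x z \<le> dist x z / L" using z(2)[OF \<psi>_K[OF assms(1) z(1)]] by simp
  then have "dist x z * L \<le> dist x z" using L_gt by (simp add: field_simps)
  then have "dist x z * (L - 1) \<le> 0" by (simp add: algebra_simps)
  then have "dist x z = 0" using L_gt by (simp add: mult_le_0_iff antisym)
  then show ?thesis using z by simp
qed

lemma V_sub_K: "V \<subseteq> K"
  using fixed_point_in_K by (auto simp: essential_fixed_points_def fixed_points_def)

lemma sum_V: "(\<Sum>v\<in>V. v) = of_nat k * b"
  using k_eq k_ge by (simp add: barycenter_def scaleR_conv_of_real)

section \<open>The bisector reflections fix the barycenter\<close>

text \<open>A bisector reflection \<open>S\<close> permutes the points \<open>\<psi> i b\<close>, so it fixes their centroid \<open>c\<close>;
  hence all vertices have the same distance to \<open>c\<close>. As \<open>S\<close> preserves \<open>V\<close> up to the translation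
  by \<open>t = S b - b\<close>, which is parallel to \<open>y - x\<close>, comparing the distances of \<open>x - t\<close> and
  \<open>y - t\<close> to \<open>c\<close> yields \<open>t = 0\<close>.\<close>

lemma reflection_index:
  assumes xy: "x \<in> V" "y \<in> V" "x \<noteq> y" and i: "i \<in> {1..N}"
  obtains j where "j \<in> {1..N}" "bisector_reflection x y ` \<psi> i ` V = \<psi> j ` V"
    "bisector_reflection x y (\<psi> i b) = \<psi> j b"
proof -
  obtain j where j: "j \<in> {1..N}" "bisector_reflection x y ` \<psi> i ` V = \<psi> j ` V"
    using symm xy i unfolding symmetry_condition_def Let_def by blast
  define \<sigma> where "\<sigma> = (x - y) / cnj (y - x)"
  have S: "bisector_reflection x y z = x + \<sigma> * cnj (z - y)" for z
    by (simp add: bisector_reflection_eq[OF xy(3)] \<sigma>_def)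
  have \<sigma>: "\<sigma> \<noteq> 0" using xy(3) by (simp add: \<sigma>_def)
  \<comment> \<open>Equal vertex sets have equal sums; since reflections and cell maps are affine,
    the barycenters of the two cells correspond as well.\<close>
  have "(\<Sum>v\<in>V. bisector_reflection x y (\<psi> i v)) = sum id (bisector_reflection x y ` \<psi> i ` V)"
    unfolding image_image by (subst sum.reindex) (auto simp: inj_on_def S \<sigma>)
  also have "\<dots> = (\<Sum>v\<in>V. \<psi> j v)"
    unfolding j(2) by (subst sum.reindex) (auto simp: inj_on_def)
  also have "\<dots> = of_nat k * \<psi> j b"
    by (simp add: \<psi>_eq sum.distrib flip: sum_divide_distrib k_eq) (simp add: sum_V algebra_simps)
  finally have 1: "(\<Sum>v\<in>V. bisector_reflection x y (\<psi> i v)) = of_nat k * \<psi> j b" .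
  have "(\<Sum>v\<in>V. bisector_reflection x y (\<psi> i v)) = of_nat k * (x + \<sigma> * cnj (\<nu> i - y)) + \<sigma> * cnj (\<Sum>v\<in>V. v) / of_real L"
    unfolding cnj_sum sum_distrib_left sum_divide_distrib
    by (simp add: S \<psi>_eq algebra_simps sum.distrib sum_subtractf k_eq)
  also have "\<dots> = of_nat k * bisector_reflection x y (\<psi> i b)"
    unfolding sum_V by (simp add: S \<psi>_eq algebra_simps)
  finally have "bisector_reflection x y (\<psi> i b) = \<psi> j b"
    using 1 k_ge by simp
  then show ?thesis using j that by blast
qed

lemma reflection_centroid:
  assumes xy: "x \<in> V" "y \<in> V" "x \<noteq> y"
  shows "bisector_reflection x y ((\<Sum>i\<in>{1..N}. \<psi> i b) / of_nat N) = (\<Sum>i\<in>{1..N}. \<psi> i b) / of_nat N"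
proof -
  have N: "N > 0" using ex_zero by force
  define \<sigma> where "\<sigma> = (x - y) / cnj (y - x)"
  have S: "bisector_reflection x y z = x + \<sigma> * cnj (z - y)" for z
    by (simp add: bisector_reflection_eq[OF xy(3)] \<sigma>_def)
  have \<sigma>: "\<sigma> \<noteq> 0" using xy(3) by (simp add: \<sigma>_def)
  have "\<forall>i\<in>{1..N}. \<exists>j. j \<in> {1..N} \<and> bisector_reflection x y (\<psi> i b) = \<psi> j b"
    using reflection_index[OF xy] by metis
  then obtain \<pi> where \<pi>: "\<And>i. i \<in> {1..N} \<Longrightarrow> \<pi> i \<in> {1..N}"
    "\<And>i. i \<in> {1..N} \<Longrightarrow> bisector_reflection x y (\<psi> i b) = \<psi> (\<pi> i) b" by metis
  have inj: "inj_on \<pi> {1..N}"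
  proof (rule inj_onI)
    fix i j assume ij: "i \<in> {1..N}" "j \<in> {1..N}" "\<pi> i = \<pi> j"
    then have "bisector_reflection x y (\<psi> i b) = bisector_reflection x y (\<psi> j b)" using \<pi> by simp
    then have "\<psi> i b = \<psi> j b" by (simp add: S \<sigma>)
    then show "i = j" using ij \<psi>_index_eq by blast
  qed
  have "\<pi> ` {1..N} = {1..N}" by (rule endo_inj_surj) (use \<pi> inj in auto)
  then have "(\<Sum>i\<in>{1..N}. \<psi> i b) = (\<Sum>i\<in>{1..N}. \<psi> (\<pi> i) b)"
    using sum.reindex[OF inj, of "\<lambda>i. \<psi> i b"] by (simp add: o_def)
  also have "\<dots> = (\<Sum>i\<in>{1..N}. bisector_reflection x y (\<psi> i b))"
    using \<pi> by simp
  also have "\<dots> = of_nat N * (x - \<sigma> * cnj y) + \<sigma> * cnj (\<Sum>i\<in>{1..N}. \<psi> i b)"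
    by (simp add: S algebra_simps sum.distrib sum_subtractf sum_distrib_left cnj_sum)
  finally have "(\<Sum>i\<in>{1..N}. \<psi> i b) = of_nat N * (x - \<sigma> * cnj y) + \<sigma> * cnj (\<Sum>i\<in>{1..N}. \<psi> i b)" .
  then show ?thesis using N by (simp add: S field_simps)
qed

text \<open>The symmetry condition concerns the small copies of \<open>V\<close> only. Subtracting
  their barycenters and rescaling by \<open>L\<close> removes the cell translations, at the price of
  the displacement of \<open>b\<close>.\<close>

lemma reflection_vertices:
  assumes xy: "x \<in> V" "y \<in> V" "x \<noteq> y" and v: "v \<in> V"
  shows "bisector_reflection x y v - (bisector_reflection x y b - b) \<in> V"
proof -
  define \<sigma> where "\<sigma> = (x - y) / cnj (y - x)"
  have S: "bisector_reflection x y z = x + \<sigma> * cnj (z - y)" for z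
    by (simp add: bisector_reflection_eq[OF xy(3)] \<sigma>_def)
  obtain i where i: "i \<in> {1..N}" using ex_zero by blast
  obtain j where j: "bisector_reflection x y ` \<psi> i ` V = \<psi> j ` V"
    "bisector_reflection x y (\<psi> i b) = \<psi> j b"
    by (rule reflection_index[OF xy i])
  obtain v' where v': "v' \<in> V" "bisector_reflection x y (\<psi> i v) = \<psi> j v'"
    using v j(1) by blast
  have "v' - b = of_real L * (\<psi> j v' - \<psi> j b)"
    by (simp add: \<psi>_eq algebra_simps)
  also have "\<dots> = bisector_reflection x y v - bisector_reflection x y b"
    unfolding v'(2)[symmetric] j(2)[symmetric] by (simp add: S \<psi>_eq algebra_simps)
  finally have "bisector_reflection x y v - (bisector_reflection x y b - b) = v'"
    by (simp add: algebra_simps)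
  then show ?thesis using v'(1) by simp
qed

lemma reflection_barycenter:
  assumes xy: "x \<in> V" "y \<in> V" "x \<noteq> y"
  shows "bisector_reflection x y b = b"
proof -
  let ?S = "bisector_reflection x y"
  define c where "c = (\<Sum>i\<in>{1..N}. \<psi> i b) / of_nat N"
  define t where "t = ?S b - b"
  have d: "dist u c = dist v c" if "u \<in> V" "v \<in> V" for u v
    using bisector_reflection_fixes_imp_dist_eq reflection_centroid that unfolding c_def by metis
  obtain \<mu> where \<mu>: "t = \<mu> *\<^sub>R (y - x)"
    by (simp add: t_def bisector_reflection_def) (metis scaleR_minus_left scaleR_minus_right minus_diff_eq)
  have "?S y = x" using xy by (simp add: bisector_reflection_eq)
  moreover have "?S x = y"
    using xy(3) by (simp add: bisector_reflection_eq divide_simps del: complex_cnj_diff)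
      (simp add: algebra_simps)
  ultimately have "x - t \<in> V" "y - t \<in> V"
    using reflection_vertices[OF xy xy(1)] reflection_vertices[OF xy xy(2)] by (auto simp: t_def)
  then have "(norm ((x - c) - t))\<^sup>2 = (norm (x - c))\<^sup>2" "(norm ((y - c) - t))\<^sup>2 = (norm (y - c))\<^sup>2"
    using d[of "x - t" x] d[of "y - t" y] xy by (simp_all add: dist_norm algebra_simps)
  then have "t \<bullet> (x - c) = t \<bullet> (y - c)"
    by (simp add: power2_norm_eq_inner inner_diff_left inner_diff_right inner_commute)
  then have "t \<bullet> (y - x) = 0" by (simp add: inner_diff_right)
  then have "t = 0" using xy(3) by (simp add: \<mu>)
  then show ?thesis by (simp add: t_def)
qed

section \<open>The vertices as a coset of the \<open>k\<close>-th roots of unity\<close>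

lemma V_eq: "V = (+) b ` X"
proof (rule equalityI; rule subsetI)
  fix v assume "v \<in> V"
  then show "v \<in> (+) b ` X" by (intro image_eqI[of _ _ "v - b"]) (auto simp: X_def)
qed (auto simp: X_def)

lemma X_card: "card X = k" and finite_X: "finite X"
proof -
  have "inj_on ((+) b) X" by simp
  then show "card X = k" "finite X"
    using finite_V k_eq by (auto simp: V_eq card_image dest: finite_imageD)
qed

text \<open>That the reflection fixes \<open>b\<close> reads
  \<open>\<xi> = \<sigma> * cnj \<eta>\<close>. This identifies the coefficient, and its modulus 1
  puts the vertices on one circle about \<open>b\<close>.\<close>

lemma X_coefficient:
  assumes "\<xi> \<in> X" "\<eta> \<in> X" "\<xi> \<noteq> \<eta>"
  shows "(\<xi> - \<eta>) / cnj (\<eta> - \<xi>) = \<xi> / cnj \<eta>" "\<eta> \<noteq> 0" "norm \<xi> = norm \<eta>"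
proof -
  define \<sigma> where "\<sigma> = (\<xi> - \<eta>) / cnj (\<eta> - \<xi>)"
  have "bisector_reflection (b + \<xi>) (b + \<eta>) b = b"
    using assms by (intro reflection_barycenter) (auto simp: X_def)
  then have \<xi>: "\<xi> = \<sigma> * cnj \<eta>"
    using assms(3) by (simp add: bisector_reflection_eq \<sigma>_def)
  show 1: "\<eta> \<noteq> 0" using \<xi> assms(3) by auto
  show "(\<xi> - \<eta>) / cnj (\<eta> - \<xi>) = \<xi> / cnj \<eta>"
    unfolding \<sigma>_def[symmetric] using \<xi> 1 by simp
  have "norm \<sigma> = 1"
    unfolding \<sigma>_def using assms(3) by (rule norm_minus_divide_cnj)
  then show "norm \<xi> = norm \<eta>" using \<xi> by (simp add: norm_mult)
qed

lemma reflection_eq: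
  assumes "\<xi> \<in> X" "\<eta> \<in> X" "\<xi> \<noteq> \<eta>"
  shows "bisector_reflection (b + \<xi>) (b + \<eta>) z = b + \<xi> / cnj \<eta> * cnj (z - b)"
proof -
  have "bisector_reflection (b + \<xi>) (b + \<eta>) z = b + \<xi> + ((\<xi> - \<eta>) / cnj (\<eta> - \<xi>)) * cnj (z - (b + \<eta>))"
    using assms(3) by (simp add: bisector_reflection_eq)
  also have "\<dots> = b + \<xi> / cnj \<eta> * cnj (z - b)"
    unfolding X_coefficient(1)[OF assms] using X_coefficient(2)[OF assms] by (simp add: field_simps)
  finally show ?thesis .
qed

text \<open>Supplies the auxiliary vertices of the group arguments below; \<open>k \<ge> 3\<close>
  enters here.\<close>

lemma X_ex_other: "\<exists>\<zeta>\<in>X. \<zeta> \<noteq> \<xi> \<and> \<zeta> \<noteq> \<eta>"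
proof (rule ccontr)
  assume "\<not> ?thesis"
  then have "X \<subseteq> {\<xi>, \<eta>}" by auto
  then have "card X \<le> card {\<xi>, \<eta>}" by (intro card_mono) auto
  also have "\<dots> \<le> 2" by (simp add: card_insert_le_m1)
  finally show False using k_ge by (simp add: X_card)
qed

lemma X_nonzero: "\<xi> \<in> X \<Longrightarrow> \<xi> \<noteq> 0"
  using X_ex_other[of \<xi> \<xi>] X_coefficient(2)[of _ \<xi>] by blast

lemma X_norm: "\<xi> \<in> X \<Longrightarrow> \<eta> \<in> X \<Longrightarrow> norm \<xi> = norm \<eta>"
  using X_coefficient(3) by blast

lemma X_cnj: "\<xi> \<in> X \<Longrightarrow> \<eta> \<in> X \<Longrightarrow> \<xi> * cnj \<xi> = \<eta> * cnj \<eta>"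
  using X_norm by (metis complex_norm_square)

text \<open>The reflection exchanging \<open>\<xi>\<close> and \<open>\<eta>\<close> sends
  \<open>\<zeta>\<close> to \<open>\<xi> / cnj \<eta> * cnj \<zeta>\<close>, which on a circle about
  the origin is the claimed product.\<close>

lemma X_closed1:
  assumes "\<xi> \<in> X" "\<eta> \<in> X" "\<zeta> \<in> X" "\<xi> \<noteq> \<eta>"
  shows "\<xi> * \<eta> / \<zeta> \<in> X"
proof -
  have "b + \<xi> / cnj \<eta> * cnj \<zeta> \<in> V"
    using reflection_vertices[of "b + \<xi>" "b + \<eta>" "b + \<zeta>"] assms reflection_barycenter[of "b + \<xi>" "b + \<eta>"]
    by (simp add: reflection_eq X_def)
  moreover have "\<xi> / cnj \<eta> * cnj \<zeta> = \<xi> * \<eta> / \<zeta>"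
    using X_cnj[OF assms(2,3)] X_nonzero assms by (simp add: field_simps)
  ultimately show ?thesis by (simp add: X_def)
qed

lemma X_closed:
  assumes "\<xi> \<in> X" "\<eta> \<in> X" "\<zeta> \<in> X"
  shows "\<xi> * \<eta> / \<zeta> \<in> X"
proof (cases "\<xi> = \<eta>")
  case True
  \<comment> \<open>The square is reached in two steps through \<open>\<mu>\<close>;
    \<open>\<mu> \<noteq> \<zeta>\<close> keeps the two factors of the second step distinct.\<close>
  obtain \<mu> where \<mu>: "\<mu> \<in> X" "\<mu> \<noteq> \<xi>" "\<mu> \<noteq> \<zeta>" using X_ex_other by blast
  have "\<xi> * \<mu> / \<zeta> \<in> X" using X_closed1 assms \<mu> by blast
  moreover have "\<xi> * \<mu> / \<zeta> \<noteq> \<xi>" using \<mu> X_nonzero assms by (simp add: field_simps)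
  ultimately have "(\<xi> * \<mu> / \<zeta>) * \<xi> / \<mu> \<in> X" using X_closed1 assms \<mu> by blast
  then show ?thesis using True \<mu> X_nonzero by simp
qed (use assms X_closed1 in blast)

text \<open>Multiplication by \<open>\<xi> / \<eta>\<close> permutes \<open>X\<close>, and comparing
  the products of all elements gives \<open>(\<xi> / \<eta>) ^ k = 1\<close>.\<close>

lemma X_ratio_power:
  assumes "\<xi> \<in> X" "\<eta> \<in> X"
  shows "\<xi> ^ k = \<eta> ^ k"
proof -
  let ?f = "\<lambda>z. \<xi> / \<eta> * z"
  have inj: "inj_on ?f X" using assms X_nonzero by (auto simp: inj_on_def)
  have "?f ` X \<subseteq> X" using X_closed[OF assms(1) _ assms(2)] by auto
  then have "?f ` X = X" using inj finite_X by (intro endo_inj_surj)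
  then have "\<Prod>X = prod (\<lambda>z. \<xi> / \<eta> * z) X"
    using prod.reindex[OF inj, of id] by (simp add: o_def)
  also have "\<dots> = (\<xi> / \<eta>) ^ k * \<Prod>X"
    by (subst prod.distrib) (simp add: X_card)
  finally have "(\<xi> / \<eta>) ^ k = 1" using X_nonzero finite_X by auto
  then show ?thesis using X_nonzero[OF assms(2)] by (simp add: field_simps)
qed

text \<open>Both sets have \<open>k\<close> elements, so one inclusion is enough; \<open>X\<close>
  is a full regular polygon.\<close>

lemma X_eq:
  assumes "\<xi> \<in> X"
  shows "X = {z. z ^ k = \<xi> ^ k}"
proof (rule card_subset_eq)
  show "finite {z. z ^ k = \<xi> ^ k}" using k_ge by (intro finite_nth_roots) auto
  show "X \<subseteq> {z. z ^ k = \<xi> ^ k}" using X_ratio_power[OF _ assms] by blast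
  show "card X = card {z. z ^ k = \<xi> ^ k}"
    using card_nth_roots[of "\<xi> ^ k" k] X_nonzero[OF assms] k_ge by (simp add: X_card)
qed

section \<open>Symmetries of the attractor\<close>

lemma dist_\<psi>: "dist (\<psi> i x) (\<psi> i y) = dist x y / L"
  using L_gt by (simp add: ifs_map_def dist_norm divide_inverse_commute flip: scaleR_diff_right)

text \<open>A map that permutes the \<open>\<psi> i\<close> up to composition maps the attractor into itself: the largest
  distance of a point of \<open>F ` K\<close> to \<open>K\<close> is at most \<open>1 / L\<close> times itself.\<close>

lemma intertwining_map_invariant:
  assumes F: "continuous_on K F"
    and \<psi>F: "\<And>i. i \<in> {1..N} \<Longrightarrow> \<exists>j\<in>{1..N}. \<forall>z. F (\<psi> i z) = \<psi> j (F z)"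
    and z: "z \<in> K"
  shows "F z \<in> K"
proof -
  have cl: "closed K" using K_compact by (rule compact_imp_closed)
  have "continuous_on K (\<lambda>z. infdist (F z) K)"
    by (intro continuous_intros F)
  then obtain x where x: "x \<in> K" "\<And>y. y \<in> K \<Longrightarrow> infdist (F y) K \<le> infdist (F x) K"
    using continuous_attains_sup[OF K_compact K_nonempty] by blast
  obtain i x' where i: "i \<in> {1..N}" "x' \<in> K" "x = \<psi> i x'" using K_cases x(1) .
  obtain j where j: "j \<in> {1..N}" "F x = \<psi> j (F x')" using \<psi>F[OF i(1)] i(3) by blast
  obtain y where y: "y \<in> K" "infdist (F x') K = dist (F x') y"
    using infdist_attains_inf[OF cl K_nonempty] by blast
  have "infdist (F x) K \<le> dist (\<psi> j (F x')) (\<psi> j y)"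
    unfolding j(2) using \<psi>_K[OF j(1) y(1)] by (rule infdist_le)
  also have "\<dots> = infdist (F x') K / L" by (simp add: dist_\<psi> y)
  also have "\<dots> \<le> infdist (F x) K / L"
    using x(2)[OF i(2)] L_gt by (simp add: divide_right_mono)
  finally have "infdist (F x) K * (L - 1) \<le> 0" using L_gt by (simp add: field_simps)
  then have "infdist (F x) K \<le> 0" using L_gt by (simp add: mult_le_0_iff)
  then have "infdist (F z) K = 0" using x(2)[OF z] infdist_nonneg[of "F z" K] by simp
  then show ?thesis using in_closed_iff_infdist_zero[OF cl K_nonempty] by blast
qed

text \<open>Both sides are real-affine in \<open>z\<close> with the same linear part, because a real
  scaling commutes with the conjugation; agreement at \<open>b\<close> is therefore enough.\<close>

lemma reflection_intertwines:
  assumes "\<xi> \<in> X" "\<eta> \<in> X" "\<xi> \<noteq> \<eta>" and i: "i \<in> {1..N}"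
  shows "\<exists>j\<in>{1..N}. \<forall>z. b + \<xi> / cnj \<eta> * cnj (\<psi> i z - b) = \<psi> j (b + \<xi> / cnj \<eta> * cnj (z - b))"
proof -
  have xy: "b + \<xi> \<in> V" "b + \<eta> \<in> V" "b + \<xi> \<noteq> b + \<eta>" using assms by (auto simp: X_def)
  obtain j where j: "j \<in> {1..N}" "bisector_reflection (b + \<xi>) (b + \<eta>) (\<psi> i b) = \<psi> j b"
    by (rule reflection_index[OF xy i])
  have eq: "b + \<xi> / cnj \<eta> * cnj (\<psi> i b - b) = \<psi> j b"
    using j(2) by (simp only: reflection_eq[OF assms(1-3)])
  have "b + \<xi> / cnj \<eta> * cnj (\<psi> i z - b) = \<psi> j (b + \<xi> / cnj \<eta> * cnj (z - b))" for z
  proof -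
    have "\<psi> i z - b = (\<psi> i b - b) + (z - b) / of_real L"
      by (simp add: \<psi>_eq diff_divide_distrib)
    then have "b + \<xi> / cnj \<eta> * cnj (\<psi> i z - b)
        = (b + \<xi> / cnj \<eta> * cnj (\<psi> i b - b)) + \<xi> / cnj \<eta> * cnj (z - b) / of_real L"
      by (simp only: complex_cnj_add complex_cnj_divide complex_cnj_complex_of_real distrib_left
          times_divide_eq_right add.assoc)
    also have "\<dots> = \<psi> j (b + \<xi> / cnj \<eta> * cnj (z - b))"
      unfolding eq by (simp add: \<psi>_eq add_divide_distrib)
    finally show ?thesis .
  qed
  then show ?thesis using j(1) by blast
qed

lemma reflection_K:
  assumes "\<xi> \<in> X" "\<eta> \<in> X" "\<xi> \<noteq> \<eta>" "z \<in> K"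
  shows "b + \<xi> / cnj \<eta> * cnj (z - b) \<in> K"
proof (rule intertwining_map_invariant[of "\<lambda>z. b + \<xi> / cnj \<eta> * cnj (z - b)"])
  show "continuous_on K (\<lambda>z. b + \<xi> / cnj \<eta> * cnj (z - b))"
    by (intro continuous_intros) (use X_nonzero[OF assms(2)] in simp)
qed (use reflection_intertwines[OF assms(1-3)] assms(4) in blast)+

text \<open>Parametrised by the complex factor instead of an angle, so that composites become
  products.\<close>

definition rot :: "complex \<Rightarrow> complex \<Rightarrow> complex" where
  "rot u z = b + u * (z - b)"

lemma X_root_mult: "u ^ k = 1 \<Longrightarrow> \<xi> \<in> X \<Longrightarrow> u * \<xi> \<in> X"
  using X_eq[of \<xi>] by (simp add: power_mult_distrib)

lemma X_ratio_root: "\<xi> \<in> X \<Longrightarrow> \<eta> \<in> X \<Longrightarrow> (\<xi> / \<eta>) ^ k = 1"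
  using X_ratio_power[of \<xi> \<eta>] X_nonzero[of \<eta>] by (simp add: power_divide)

text \<open>The rotation is a composite of two bisector reflections, the first taking
  \<open>\<eta>\<close> to \<open>\<xi>\<close> and the second \<open>\<xi>\<close> to
  \<open>u * \<eta>\<close>; each carries cell maps to cell maps.\<close>

lemma rot_intertwines:
  assumes u: "u ^ k = 1" and i: "i \<in> {1..N}"
  shows "\<exists>j\<in>{1..N}. \<forall>z. rot u (\<psi> i z) = \<psi> j (rot u z)"
proof (cases "u = 1")
  case True
  then show ?thesis using i by (auto simp: rot_def)
next
  case False
  obtain \<eta> where \<eta>: "\<eta> \<in> X" using X_ex_other by blast
  have u\<eta>: "u * \<eta> \<in> X" using X_root_mult[OF u \<eta>] .
  obtain \<xi> where \<xi>: "\<xi> \<in> X" "\<xi> \<noteq> \<eta>" "\<xi> \<noteq> u * \<eta>" using X_ex_other by blast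
  obtain j where j: "j \<in> {1..N}"
    "\<And>z. b + \<xi> / cnj \<eta> * cnj (\<psi> i z - b) = \<psi> j (b + \<xi> / cnj \<eta> * cnj (z - b))"
    using reflection_intertwines[OF \<xi>(1) \<eta> \<xi>(2) i] by blast
  obtain l where l: "l \<in> {1..N}"
    "\<And>z. b + \<xi> / cnj (u * \<eta>) * cnj (\<psi> j z - b) = \<psi> l (b + \<xi> / cnj (u * \<eta>) * cnj (z - b))"
    using reflection_intertwines[OF \<xi>(1) u\<eta> \<xi>(3) j(1)] by blast
  have nz: "\<eta> \<noteq> 0" "u * \<eta> \<noteq> 0" using X_nonzero \<eta> u\<eta> by blast+
  have "rot u z = b + \<xi> / cnj (u * \<eta>) * cnj (b + \<xi> / cnj \<eta> * cnj (z - b) - b)" for z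
  proof -
    have "\<xi> / cnj (u * \<eta>) * cnj (b + \<xi> / cnj \<eta> * cnj (z - b) - b)
        = (\<xi> * cnj \<xi>) / (cnj (u * \<eta>) * \<eta>) * (z - b)"
      by simp
    also have "(\<xi> * cnj \<xi>) / (cnj (u * \<eta>) * \<eta>) = u"
      unfolding X_cnj[OF \<xi>(1) u\<eta>] using nz by (simp add: field_simps)
    finally show ?thesis by (simp add: rot_def)
  qed
  then have "\<forall>z. rot u (\<psi> i z) = \<psi> l (rot u z)"
    by (simp only: j(2) l(2) simp_thms)
  then show ?thesis using l(1) by blast
qed

lemma rot_K: "u ^ k = 1 \<Longrightarrow> z \<in> K \<Longrightarrow> rot u z \<in> K"
  by (rule intertwining_map_invariant[of "rot u"])
    (use rot_intertwines in \<open>auto intro!: continuous_intros simp: rot_def\<close>)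

section \<open>Connectedness of the attractor\<close>

text \<open>Each step of a chain of vertices stays inside one cell, and successive cells share the
  vertex in between; this turns the connectivity of vertices into one of indices.\<close>

lemma index_connected:
  assumes i: "i \<in> {1..N}" and j: "j \<in> {1..N}"
  shows "(i, j) \<in> {(i, j). i \<in> {1..N} \<and> j \<in> {1..N} \<and> \<psi> i ` K \<inter> \<psi> j ` K \<noteq> {}}\<^sup>*"
    (is "_ \<in> ?A\<^sup>*")
proof -
  define W where "W = (\<Union>i\<in>{1..N}. \<psi> i ` V)"
  define E where "E = {(x, y). x \<in> W \<and> y \<in> W \<and> (\<exists>i\<in>{1..N}. x \<in> \<psi> i ` K \<and> y \<in> \<psi> i ` K)}"
  have *: "(x, y) \<in> E\<^sup>*" if "x \<in> W" "y \<in> W" for x y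
    using conn that unfolding connectivity_condition_def Let_def W_def E_def by blast
  have **: "(i, j) \<in> ?A\<^sup>*"
    if "(x, y) \<in> E\<^sup>*" "x \<in> \<psi> i ` K" "y \<in> \<psi> j ` K" "i \<in> {1..N}" "j \<in> {1..N}" for i j x y
    using that
  proof (induction arbitrary: j rule: rtrancl_induct)
    case base
    then show ?case by (intro r_into_rtrancl) auto
  next
    case (step y z)
    then obtain m where m: "m \<in> {1..N}" "y \<in> \<psi> m ` K" "z \<in> \<psi> m ` K" by (auto simp: E_def)
    have "(i, m) \<in> ?A\<^sup>*" using step m by blast
    moreover have "(m, j) \<in> ?A" using step.prems m by auto
    ultimately show ?case by (rule rtrancl_into_rtrancl)
  qed
  obtain \<xi> where "\<xi> \<in> X" using X_ex_other by blast
  then have v: "b + \<xi> \<in> V" by (simp add: X_def)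
  then have "b + \<xi> \<in> K" using V_sub_K by blast
  moreover have "\<psi> i (b + \<xi>) \<in> W" "\<psi> j (b + \<xi>) \<in> W" using v i j by (auto simp: W_def)
  ultimately show ?thesis using * ** i j by blast
qed

text \<open>A chain of level \<open>n\<close>, shrunk into a cell, has steps of level
  \<open>Suc n\<close>; chains in different cells are linked at points common to the cells. The
  \<open>+ 1\<close> makes the bound strict at level 0.\<close>

lemma epsilon_chain:
  assumes "x \<in> K" "y \<in> K"
  shows "(x, y) \<in> {(x, y). x \<in> K \<and> y \<in> K \<and> dist x y < (diameter K + 1) / L ^ n}\<^sup>*"
  using assms
proof (induction n arbitrary: x y)
  case 0
  have "dist x y < diameter K + 1"
    using diameter_bounded_bound[OF compact_imp_bounded[OF K_compact] 0] by simp
  then show ?case using 0 by (intro r_into_rtrancl) auto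
next
  case (Suc n)
  define D where "D = diameter K + 1"
  let ?R = "\<lambda>n. {(x, y). x \<in> K \<and> y \<in> K \<and> dist x y < D / L ^ n}"
  have cell: "(\<psi> i x, \<psi> i y) \<in> (?R (Suc n))\<^sup>*" if "i \<in> {1..N}" "x \<in> K" "y \<in> K" for i x y
  proof -
    have "(x, y) \<in> (?R n)\<^sup>*" using Suc.IH[OF that(2,3)] by (simp add: D_def)
    then show ?thesis
    proof (induction rule: rtrancl_induct)
      case (step y z)
      have "(\<psi> i y, \<psi> i z) \<in> ?R (Suc n)"
        using step(2) that L_gt by (auto simp: \<psi>_K dist_\<psi> field_simps)
      with step(3) show ?case by (rule rtrancl_into_rtrancl)
    qed auto
  qed
  have cells: "(\<psi> i x, \<psi> j y) \<in> (?R (Suc n))\<^sup>*"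
    if "(i, j) \<in> {(i, j). i \<in> {1..N} \<and> j \<in> {1..N} \<and> \<psi> i ` K \<inter> \<psi> j ` K \<noteq> {}}\<^sup>*"
      "i \<in> {1..N}" "x \<in> K" "y \<in> K" for i j x y
    using that
  proof (induction arbitrary: y rule: rtrancl_induct)
    case base
    then show ?case using cell by blast
  next
    case (step j m)
    then obtain u v where uv: "u \<in> K" "v \<in> K" "\<psi> j u = \<psi> m v" "m \<in> {1..N}" by auto
    have "(\<psi> i x, \<psi> j u) \<in> (?R (Suc n))\<^sup>*"
      by (rule step.IH[OF step.prems(1,2) uv(1)])
    then have "(\<psi> i x, \<psi> m v) \<in> (?R (Suc n))\<^sup>*" by (simp only: uv(3))
    moreover have "(\<psi> m v, \<psi> m y) \<in> (?R (Suc n))\<^sup>*" using cell uv step by blast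
    ultimately show ?case by (rule rtrancl_trans)
  qed
  obtain i x' where i: "i \<in> {1..N}" "x' \<in> K" "x = \<psi> i x'" using K_cases Suc.prems(1) .
  obtain j y' where j: "j \<in> {1..N}" "y' \<in> K" "y = \<psi> j y'" using K_cases Suc.prems(2) .
  have "(x, y) \<in> (?R (Suc n))\<^sup>*"
    unfolding i(3) j(3) using cells index_connected i j by blast
  then show ?case by (simp only: D_def)
qed

text \<open>The two parts of a separation would have positive distance, and a chain with shorter
  steps could not pass from one to the other.\<close>

lemma K_connected: "connected K"
  unfolding connected_closed
proof clarify
  fix A B assume AB: "closed A" "closed B" "K \<subseteq> A \<union> B" "A \<inter> B \<inter> K = {}"
    "A \<inter> K \<noteq> {}" "B \<inter> K \<noteq> {}"
  have "\<exists>d>0. \<forall>x\<in>A \<inter> K. \<forall>y\<in>B \<inter> K. d \<le> dist x y"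
    using AB K_compact by (intro separate_compact_closed) (auto simp: closed_Int_compact compact_imp_closed closed_Int)
  then obtain d where d: "d > 0" "\<And>x y. x \<in> A \<inter> K \<Longrightarrow> y \<in> B \<inter> K \<Longrightarrow> d \<le> dist x y" by blast
  obtain n where n: "(diameter K + 1) / d < L ^ n"
    using real_arch_pow[OF L_gt] by blast
  then have n': "(diameter K + 1) / L ^ n < d" using d L_gt by (simp add: field_simps)
  obtain x y where xy: "x \<in> A \<inter> K" "y \<in> B \<inter> K" using AB by blast
  have "(x, y) \<in> {(x, y). x \<in> K \<and> y \<in> K \<and> dist x y < (diameter K + 1) / L ^ n}\<^sup>*"
    using epsilon_chain[of x y n] xy by auto
  then have "y \<in> A \<inter> K"
  proof (induction rule: rtrancl_induct)
    case (step y z)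
    then have "z \<notin> B" using d(2)[of y z] n' by auto
    then show ?case using step AB by auto
  qed (use xy in auto)
  then show False using xy AB by auto
qed

end

section \<open>Lines meeting a connected set in one point\<close>

text \<open>Collapsing the other side of the line to \<open>p\<close> is continuous, as the two
  definitions agree on the line.\<close>

lemma connected_half_through_cut_point:
  fixes S :: "'a::real_inner set"
  assumes S: "connected S" and p: "p \<in> S"
    and cut: "\<And>z. z \<in> S \<Longrightarrow> (z - p) \<bullet> e = 0 \<Longrightarrow> z = p"
  shows "connected {z \<in> S. (z - p) \<bullet> e \<le> 0}"
proof -
  let ?r = "\<lambda>z. if (z - p) \<bullet> e \<le> 0 then z else p"
  have "continuous_on S ?r"
    by (intro continuous_on_cases_le continuous_intros) (use cut in auto)
  then have "connected (?r ` S)" using S by (rule connected_continuous_image)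
  also have "?r ` S = {z \<in> S. (z - p) \<bullet> e \<le> 0}" using p by (auto simp: image_iff split: if_splits)
  finally show ?thesis .
qed

lemma connected_negative_side:
  fixes S :: "'a::euclidean_space set"
  assumes S: "connected S" and ne: "\<And>z. z \<in> S \<Longrightarrow> (z - p) \<bullet> e \<noteq> 0"
    and x: "x \<in> S" "(x - p) \<bullet> e < 0" and y: "y \<in> S"
  shows "(y - p) \<bullet> e < 0"
proof (rule ccontr)
  assume "\<not> ?thesis"
  then have "\<exists>z\<in>S. e \<bullet> z = e \<bullet> p"
    using x(2) by (intro connected_ivt_hyperplane[OF S x(1) y])
      (auto simp: inner_diff_left inner_commute[of e])
  then show False using ne by (metis inner_commute inner_diff_left right_minus_eq)
qed

text \<open>For two chords of the unit circle from 1, passing to half angles factors the inner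
  product, so its sign can be read off.\<close>

lemma inner_unit_circle:
  "(cis \<phi> - 1) \<bullet> (cis \<theta> - 1) = 4 * sin (\<phi> / 2) * sin (\<theta> / 2) * cos (\<phi> / 2 - \<theta> / 2)"
proof -
  define x y where "x = \<phi> / 2" and "y = \<theta> / 2"
  have "(cis (2 * x) - 1) \<bullet> (cis (2 * y) - 1) = 4 * sin x * sin y * cos (x - y)"
  proof -
    have "(cis (2 * x) - 1) \<bullet> (cis (2 * y) - 1)
        = (2 * (sin x)\<^sup>2) * (2 * (sin y)\<^sup>2) + (2 * sin x * cos x) * (2 * sin y * cos y)"
      by (simp add: inner_complex_def cos_double_sin sin_double)
    also have "\<dots> = 4 * sin x * sin y * cos (x - y)"
      by (simp add: cos_diff algebra_simps power2_eq_square)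
    finally show ?thesis .
  qed
  then show ?thesis by (simp add: x_def y_def)
qed

lemma inner_mult_left_complex: "(a * z) \<bullet> (a * w) = (norm a)\<^sup>2 * (z \<bullet> w)" for a z w :: complex
  unfolding cmod_power2 by (simp add: inner_complex_def power2_eq_square algebra_simps)

context nested_fractal
begin

text \<open>The part of \<open>K\<close> on the side of the line containing \<open>rot u p\<close> would be mapped by
  \<open>rot u\<close> into itself minus the point \<open>p\<close>, although \<open>rot u\<close> has finite order.\<close>

lemma rotated_cut_point:
  assumes p: "p \<in> K" and u: "u ^ k = 1"
    and cut: "\<And>z. z \<in> K \<Longrightarrow> (z - p) \<bullet> e = 0 \<Longrightarrow> z = p"
    and neg: "(rot u p - p) \<bullet> e < 0" and pos: "(rot (inverse u) p - p) \<bullet> e > 0"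
  shows False
proof -
  define D where "D = {z \<in> K. (z - p) \<bullet> e \<le> 0}"
  have u0: "u \<noteq> 0" using u k_ge by (auto simp: power_0_left)
  have conn: "connected (rot u ` D)"
    unfolding D_def
    by (intro connected_continuous_image connected_half_through_cut_point K_connected p cut)
      (auto simp: rot_def intro!: continuous_intros)
  have pD: "p \<in> D" using p by (simp add: D_def)
  \<comment> \<open>The only preimage of \<open>p\<close> lies strictly on the positive side. Hence
    the rotated half misses the whole line and, being connected, stays on the side of
    \<open>rot u p\<close>.\<close>
  have p_notin: "p \<notin> rot u ` D"
  proof
    assume "p \<in> rot u ` D"
    then obtain z where z: "z \<in> D" "p = rot u z" by blast
    have "rot (inverse u) p = z" unfolding z(2) using u0 by (simp add: rot_def field_simps)
    then show False using z(1) pos by (simp add: D_def)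
  qed
  have ne: "(z - p) \<bullet> e \<noteq> 0" if "z \<in> rot u ` D" for z
    using that cut[of z] p_notin rot_K[OF u] by (auto simp: D_def)
  have step: "rot u z \<in> D \<and> rot u z \<noteq> p" if "z \<in> D" for z
  proof -
    have "rot u z \<in> rot u ` D" using that by blast
    then have "(rot u z - p) \<bullet> e < 0"
      using connected_negative_side[OF conn ne _ neg] pD by blast
    then show ?thesis using that rot_K[OF u] by (auto simp: D_def)
  qed
  have pow: "rot (u ^ n) p \<in> D \<and> rot (u ^ n) p \<noteq> p" if "n > 0" for n
    using that
  proof (induction n rule: nat_induct_non_zero)
    case 1
    then show ?case using step[OF pD] by simp
  next
    case (Suc n)
    have "rot (u ^ Suc n) p = rot u (rot (u ^ n) p)" by (simp add: rot_def)
    then show ?case using step Suc by metis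
  qed
  have "rot (u ^ k) p = p" by (simp add: u rot_def)
  then show False using pow[of k] k_ge by simp
qed

end

section \<open>Contact of two cells for odd \<open>k\<close>\<close>

locale odd_nested_fractal = nested_fractal +
  assumes odd_k: "odd k"
begin

text \<open>Taking complex conjugates in \<open>\<xi> - \<xi>' = \<eta> - \<eta>'\<close> gives \<open>\<xi> * \<xi>' = \<eta> * \<eta>'\<close>.\<close>

lemma X_chord_unique:
  assumes X: "\<xi> \<in> X" "\<xi>' \<in> X" "\<eta> \<in> X" "\<eta>' \<in> X"
    and eq: "\<xi> - \<xi>' = \<eta> - \<eta>'" and ne: "\<xi> \<noteq> \<xi>'"
  shows "\<xi> = \<eta>" "\<xi>' = \<eta>'"
proof -
  have nz: "\<xi> \<noteq> 0" "\<xi>' \<noteq> 0" "\<eta> \<noteq> 0" "\<eta>' \<noteq> 0" using X X_nonzero by auto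
  define c where "c = \<xi> * cnj \<xi>"
  have "\<xi> * cnj \<xi> = c" "\<xi>' * cnj \<xi>' = c" "\<eta> * cnj \<eta> = c" "\<eta>' * cnj \<eta>' = c"
    using X_cnj X unfolding c_def by blast+
  then have c: "cnj \<xi> = c / \<xi>" "cnj \<xi>' = c / \<xi>'" "cnj \<eta> = c / \<eta>" "cnj \<eta>' = c / \<eta>'"
    using nz by (simp_all add: eq_divide_eq mult.commute)
  have c0: "c \<noteq> 0" using nz by (simp add: c_def)
  have "cnj (\<xi> - \<xi>') = cnj (\<eta> - \<eta>')" by (simp only: eq)
  then have "c * (1 / \<xi> - 1 / \<xi>') = c * (1 / \<eta> - 1 / \<eta>')"
    by (simp add: c right_diff_distrib)
  then have "1 / \<xi> - 1 / \<xi>' = 1 / \<eta> - 1 / \<eta>'" using c0 by simp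
  then have "- (\<xi> - \<xi>') / (\<xi> * \<xi>') = - (\<eta> - \<eta>') / (\<eta> * \<eta>')"
    using nz by (simp add: diff_frac_eq)
  then have prod: "\<xi> * \<xi>' = \<eta> * \<eta>'"
    using nz ne unfolding eq by (auto simp: frac_eq_eq eq[symmetric])
  have \<eta>': "\<eta>' = \<eta> - \<xi> + \<xi>'" using eq by (simp add: algebra_simps)
  have "(\<xi> - \<eta>) * (\<xi> + \<eta>') = \<xi> * \<xi>' - \<eta> * \<eta>'" unfolding \<eta>' by (simp add: algebra_simps)
  then have "\<xi> = \<eta> \<or> \<xi> = - \<eta>'" using prod by (simp add: eq_neg_iff_add_eq_0)
  \<comment> \<open>Oddness excludes opposite vertices: their common \<open>k\<close>-th power would
    be its own negative.\<close>
  moreover have "\<xi> \<noteq> - \<eta>'"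
  proof
    assume "\<xi> = - \<eta>'"
    then have "\<xi> ^ k = - (\<eta>' ^ k)" using odd_k by simp
    then have "\<eta>' ^ k = 0" using X_ratio_power[OF X(1,4)] by simp
    then show False using nz by simp
  qed
  ultimately show "\<xi> = \<eta>" by blast
  then show "\<xi>' = \<eta>'" using eq by simp
qed

lemma cell_vertex_eq_iff: "\<psi> i (b + \<xi>) = \<psi> j (b + \<xi>') \<longleftrightarrow> \<xi> - \<xi>' = of_real L * (\<nu> j - \<nu> i)"
  by (auto simp: \<psi>_eq field_simps)

lemma cell_vertex_neq:
  "i \<in> {1..N} \<Longrightarrow> j \<in> {1..N} \<Longrightarrow> i \<noteq> j \<Longrightarrow> \<psi> i (b + \<xi>) = \<psi> j (b + \<xi>') \<Longrightarrow> \<xi> \<noteq> \<xi>'"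
  using \<psi>_index_eq by blast

text \<open>The translations of the cells determine the chord \<open>\<xi> - \<xi>'\<close>, and a
  nonzero chord of the polygon determines its end points.\<close>

lemma common_vertex_unique:
  assumes ij: "i \<in> {1..N}" "j \<in> {1..N}" "i \<noteq> j"
    and X: "\<xi> \<in> X" "\<xi>' \<in> X" "\<eta> \<in> X" "\<eta>' \<in> X"
    and eq: "\<psi> i (b + \<xi>) = \<psi> j (b + \<xi>')" "\<psi> i (b + \<eta>) = \<psi> j (b + \<eta>')"
  shows "\<xi> = \<eta>" "\<xi>' = \<eta>'"
proof -
  have "\<xi> - \<xi>' = \<eta> - \<eta>'" using eq by (simp add: cell_vertex_eq_iff)
  then show "\<xi> = \<eta>" "\<xi>' = \<eta>'" using X_chord_unique[OF X] cell_vertex_neq[OF ij eq(1)] by auto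
qed

lemma common_point_is_vertex:
  assumes ij: "i \<in> {1..N}" "j \<in> {1..N}" "i \<noteq> j" and z: "z \<in> \<psi> i ` K" "z \<in> \<psi> j ` K"
  obtains \<xi> \<xi>' where "\<xi> \<in> X" "\<xi>' \<in> X" "z = \<psi> i (b + \<xi>)" "\<psi> i (b + \<xi>) = \<psi> j (b + \<xi>')"
proof -
  have "z \<in> \<psi> i ` V \<inter> \<psi> j ` V" using nest ij z unfolding nesting_def by blast
  then show ?thesis using that unfolding V_eq by auto
qed

text \<open>The reflection swapping the two cells at a common vertex fixes the perpendicular line
  through that vertex, so the points of a cell on this line belong to both cells.\<close>

lemma common_vertex_cut:
  assumes ij: "i \<in> {1..N}" "j \<in> {1..N}" "i \<noteq> j"
    and X: "\<xi> \<in> X" "\<xi>' \<in> X" and eq: "\<psi> i (b + \<xi>) = \<psi> j (b + \<xi>')"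
    and z: "z \<in> K" "(z - (b + \<xi>)) \<bullet> (\<xi>' - \<xi>) = 0"
  shows "z = b + \<xi>"
proof -
  have ne: "\<xi> \<noteq> \<xi>'" by (rule cell_vertex_neq[OF ij eq])
  define y where "y = z - (b + \<xi>)"
  define e where "e = \<xi>' - \<xi>"
  have nz: "\<xi>' \<noteq> 0" "cnj e \<noteq> 0" using X_nonzero X ne by (auto simp: e_def)
  have "y * cnj e + e * cnj y = of_real (2 * (y \<bullet> e))"
    by (simp add: complex_eq_iff inner_complex_def algebra_simps)
  also have "\<dots> = 0" using z(2) by (simp add: y_def e_def)
  finally have "(- e) / cnj e * cnj y = y"
    using nz by (simp add: field_simps neg_eq_iff_add_eq_0)
  moreover have "(- e) / cnj e = \<xi> / cnj \<xi>'"
    using X_coefficient(1)[OF X ne] by (simp add: e_def)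
  ultimately have y: "\<xi> / cnj \<xi>' * cnj y = y" by metis
  \<comment> \<open>The linear part of the reflection fixes the offset \<open>y\<close>, so the
    reflected point has the same offset from \<open>\<xi>'\<close> as \<open>z\<close> has from
    \<open>\<xi>\<close>. In the two cells these are the same point.\<close>
  have "\<xi> / cnj \<xi>' * cnj (z - b) = \<xi> / cnj \<xi>' * cnj \<xi> + \<xi> / cnj \<xi>' * cnj y"
    by (simp add: y_def algebra_simps)
  also have "\<xi> / cnj \<xi>' * cnj \<xi> = \<xi>'"
    using X_cnj[OF X] nz by simp
  finally have F: "b + \<xi> / cnj \<xi>' * cnj (z - b) = b + \<xi>' + y" using y by simp
  have "\<psi> i z = \<psi> j (b + \<xi>' + y)"
    using eq by (simp add: y_def \<psi>_eq field_simps)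
  moreover have "b + \<xi>' + y \<in> K" using reflection_K[OF X ne z(1)] by (simp only: F)
  ultimately have "\<psi> i z \<in> \<psi> i ` K" "\<psi> i z \<in> \<psi> j ` K" using z(1) by blast+
  then obtain \<eta> \<eta>' where \<eta>: "\<eta> \<in> X" "\<eta>' \<in> X" "\<psi> i z = \<psi> i (b + \<eta>)" "\<psi> i (b + \<eta>) = \<psi> j (b + \<eta>')"
    by (rule common_point_is_vertex[OF ij])
  have "z = b + \<eta>" using \<eta>(3) by (simp only: \<psi>_eq_iff)
  then show ?thesis using common_vertex_unique(1)[OF ij X \<eta>(1,2) eq \<eta>(4)] by simp
qed

section \<open>Roots of unity and the possible rotation angles\<close>

abbreviation \<omega> :: complex where "\<omega> \<equiv> cis (2 * pi / real k)"
abbreviation \<tau> :: complex where "\<tau> \<equiv> cis ((real k + 1) / real k * pi)"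
abbreviation \<tau>' :: complex where "\<tau>' \<equiv> cis ((real k - 1) / real k * pi)"

lemma \<omega>_root: "\<omega> ^ k = 1"
  using k_ge by (simp add: Complex.DeMoivre)

lemma \<omega>_power_eq_iff: "\<omega> ^ m = \<omega> ^ n \<longleftrightarrow> m mod k = n mod k"
proof -
  have mod: "\<omega> ^ n = \<omega> ^ (n mod k)" for n
  proof -
    have "\<omega> ^ n = \<omega> ^ (k * (n div k) + n mod k)" by simp
    also have "\<dots> = \<omega> ^ (n mod k)" by (simp only: power_add power_mult \<omega>_root power_one mult_1)
    finally show ?thesis .
  qed
  have "bij_betw (\<lambda>j. \<omega> ^ j) {..<k} {z. z ^ k = 1}"
    using Complex.bij_betw_roots_unity[of k] k_ge unfolding Complex.DeMoivre by (simp only: mult_ac times_divide_eq_right)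
  then have "\<omega> ^ (m mod k) = \<omega> ^ (n mod k) \<longleftrightarrow> m mod k = n mod k"
    using k_ge by (auto simp: bij_betw_def inj_on_def)
  then show ?thesis using mod[of m] mod[of n] by simp
qed

lemma root_eq_\<omega>_power:
  assumes "z ^ k = 1"
  obtains n where "n < k" "z = \<omega> ^ n"
proof -
  have "bij_betw (\<lambda>j. \<omega> ^ j) {..<k} {z. z ^ k = 1}"
    using Complex.bij_betw_roots_unity[of k] k_ge unfolding Complex.DeMoivre by (simp only: mult_ac times_divide_eq_right)
  then show ?thesis using assms that by (auto simp: bij_betw_def image_iff set_eq_iff)
qed

lemma \<tau>_mult: "\<tau> * \<tau>' = 1"
proof -
  have "(real k + 1) / real k * pi + (real k - 1) / real k * pi = 2 * pi"
    using k_ge by (simp add: field_simps)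
  then show ?thesis by (simp add: cis_mult)
qed

lemma \<tau>_square: "\<tau> ^ 2 = \<omega>"
proof -
  have "real 2 * ((real k + 1) / real k * pi) = 2 * pi + 2 * pi / real k"
    using k_ge by (simp add: field_simps)
  then show ?thesis unfolding Complex.DeMoivre by (simp only: cis_mult[symmetric] cis_2pi mult_1)
qed

lemma \<tau>_root: "\<tau> ^ k = 1"
proof -
  have "real k * ((real k + 1) / real k * pi) = real (k + 1) * pi"
    using k_ge by (simp add: field_simps)
  moreover obtain m where "k + 1 = 2 * m" using odd_k by (metis evenE odd_even_add odd_one)
  ultimately have "real k * ((real k + 1) / real k * pi) = 2 * pi * of_int (int m)" by simp
  then show ?thesis unfolding Complex.DeMoivre by (simp only: cis_multiple_2pi Ints_of_int)
qed

text \<open>The square of \<open>\<tau>\<close> is the primitive root \<open>\<omega>\<close>, and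
  \<open>\<tau>\<close> itself is a \<open>k\<close>-th root of unity because \<open>k + 1\<close>
  is even; so its order is exactly \<open>k\<close>.\<close>

lemma \<tau>_power_eq_iff: "\<tau> ^ m = \<tau> ^ n \<longleftrightarrow> int k dvd int m - int n"
proof -
  have "\<tau> ^ m = \<tau> ^ n \<longleftrightarrow> m mod k = n mod k"
  proof
    assume "\<tau> ^ m = \<tau> ^ n"
    then have "(\<tau> ^ m) ^ 2 = (\<tau> ^ n) ^ 2" by simp
    then have "\<omega> ^ m = \<omega> ^ n" unfolding \<tau>_square[symmetric] by (metis power_mult mult.commute)
    then show "m mod k = n mod k" by (simp add: \<omega>_power_eq_iff)
  next
    have mod: "\<tau> ^ n = \<tau> ^ (n mod k)" for n
    proof -
      have "\<tau> ^ n = \<tau> ^ (k * (n div k) + n mod k)" by simp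
      also have "\<dots> = \<tau> ^ (n mod k)" by (simp only: power_add power_mult \<tau>_root power_one mult_1)
      finally show ?thesis .
    qed
    assume "m mod k = n mod k"
    then show "\<tau> ^ m = \<tau> ^ n" using mod[of m] mod[of n] by simp
  qed
  also have "\<dots> \<longleftrightarrow> int m mod int k = int n mod int k" by (metis of_nat_eq_iff of_nat_mod)
  finally show ?thesis by (simp add: mod_eq_dvd_iff)
qed

lemma \<tau>_neq: "\<tau> \<noteq> \<tau>'"
proof
  assume "\<tau> = \<tau>'"
  then have "\<tau> ^ 2 = \<tau> ^ 0" using \<tau>_mult by (simp add: power2_eq_square)
  then have "int k dvd 2" using \<tau>_power_eq_iff[of 2 0] by simp
  then show False using k_ge by (auto dest: zdvd_imp_le)
qed

text \<open>Unless \<open>\<xi>'\<close> is one of the two vertices farthest from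
  \<open>\<xi>\<close>, the neighbours of \<open>\<xi>\<close> lie strictly on opposite sides of the
  cut line through \<open>\<xi>\<close>, which \<open>rotated_cut_point\<close> forbids.\<close>

lemma common_vertex_ratio:
  assumes ij: "i \<in> {1..N}" "j \<in> {1..N}" "i \<noteq> j"
    and X: "\<xi> \<in> X" "\<xi>' \<in> X" and eq: "\<psi> i (b + \<xi>) = \<psi> j (b + \<xi>')"
  shows "\<xi>' / \<xi> = \<tau> \<or> \<xi>' / \<xi> = \<tau>'"
proof (rule ccontr)
  assume contra: "\<not> ?thesis"
  obtain n where n: "n < k" "\<xi>' / \<xi> = \<omega> ^ n" using root_eq_\<omega>_power X_ratio_root X by blast
  have \<xi>0: "\<xi> \<noteq> 0" using X_nonzero X by blast
  define h where "h = pi / real k"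
  define t where "t = real n * h"
  have cis: "\<omega> ^ n = cis (2 * t)" "\<omega> = cis (2 * h)" "inverse \<omega> = cis (- (2 * h))"
    by (simp_all add: t_def h_def Complex.DeMoivre mult_ac)
  have "n \<noteq> 0"
    using n(2) \<xi>0 cell_vertex_neq[OF ij eq] by (cases n) auto
  have n1: "2 * n \<noteq> k + 1"
  proof
    assume "2 * n = k + 1"
    then have "real (2 * n) = real (k + 1)" by (rule arg_cong)
    then have "real n = (real k + 1) / 2" by simp
    then have "2 * t = (real k + 1) / real k * pi" by (simp add: t_def h_def)
    then show False using contra n cis by simp
  qed
  have n2: "2 * n + 1 \<noteq> k"
  proof
    assume "2 * n + 1 = k"
    then have "real (2 * n + 1) = real k" by (rule arg_cong)
    then have "real n = (real k - 1) / 2" by simp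
    then have "2 * t = (real k - 1) / real k * pi" by (simp add: t_def h_def)
    then show False using contra n cis by simp
  qed
  have side: "(rot (cis (2 * \<phi>)) (b + \<xi>) - (b + \<xi>)) \<bullet> (\<xi>' - \<xi>)
      = (norm \<xi>)\<^sup>2 * (4 * sin \<phi> * sin t * cos (\<phi> - t))" for \<phi>
  proof -
    have "\<xi>' = \<xi> * cis (2 * t)" using n(2) \<xi>0 cis by (simp add: field_simps)
    then have 1: "\<xi>' - \<xi> = \<xi> * (cis (2 * t) - 1)" by (simp add: algebra_simps)
    have 2: "rot (cis (2 * \<phi>)) (b + \<xi>) - (b + \<xi>) = \<xi> * (cis (2 * \<phi>) - 1)"
      by (simp add: rot_def algebra_simps)
    show ?thesis unfolding 1 2 inner_mult_left_complex inner_unit_circle by simp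
  qed
  have h: "0 < h" "real k * h = pi" using k_ge by (auto simp: h_def)
  have t: "0 < t" "t < pi"
    using \<open>n \<noteq> 0\<close> h n(1) by (auto simp: t_def simp flip: h(2))
  have "h < pi"
    using h k_ge by (simp flip: h(2))
  then have pos: "0 < (norm \<xi>)\<^sup>2 * (4 * sin h * sin t)"
    using h t \<xi>0 sin_gt_zero by (intro mult_pos_pos) auto
  have A: "(rot \<omega> (b + \<xi>) - (b + \<xi>)) \<bullet> (\<xi>' - \<xi>) = ((norm \<xi>)\<^sup>2 * (4 * sin h * sin t)) * cos (t - h)"
    unfolding cis side by (simp add: cos_diff)
  have B: "(rot (inverse \<omega>) (b + \<xi>) - (b + \<xi>)) \<bullet> (\<xi>' - \<xi>) = - ((norm \<xi>)\<^sup>2 * (4 * sin h * sin t)) * cos (t + h)"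
    using side[of "- h"] cos_minus[of "t + h"] unfolding cis by (simp add: add.commute)
  have inv: "inverse \<omega> ^ k = 1" by (simp only: power_inverse \<omega>_root inverse_1)
  have K: "b + \<xi> \<in> K" using X V_sub_K by (auto simp: X_def)
  note cut = common_vertex_cut[OF ij X eq]
  have tn: "t - h = (real n - 1) * h" "t + h = (real n + 1) * h" by (simp_all add: t_def algebra_simps)
  obtain m where "k = 2 * m + 1" using odd_k by (rule oddE)
  \<comment> \<open>By parity, excluding \<open>k - 1\<close> and \<open>k + 1\<close> leaves enough
    room for \<open>t - h\<close> and \<open>t + h\<close> to lie on the same side of
    \<open>pi / 2\<close>. Their cosines then have equal signs, and \<open>A\<close> and
    \<open>B\<close> opposite ones.\<close>
  then have "2 * n + 3 \<le> k \<or> k + 3 \<le> 2 * n" using n1 n2 by presburger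
  then consider "2 * n + 3 \<le> k" | "k + 3 \<le> 2 * n" by blast
  then show False
  proof cases
    case 1
    have "(real n + 1) * h < real k / 2 * h" using 1 h by (intro mult_strict_right_mono) linarith+
    then have "t + h < pi / 2" using h tn by simp
    then have "cos (t - h) > 0" "cos (t + h) > 0" using t h by (auto intro!: cos_gt_zero_pi)
    then show False
      using rotated_cut_point[OF K inv, of "\<xi>' - \<xi>"] A B pos cut by (simp add: mult_pos_pos)
  next
    case 2
    have "real k / 2 * h < (real n - 1) * h" using 2 h by (intro mult_strict_right_mono) linarith+
    then have l: "pi / 2 < t - h" using h tn by simp
    have "(real n + 1) * h \<le> real k * h" using n(1) h by (intro mult_right_mono) linarith+
    then have u: "t + h \<le> pi" using h tn by simp
    have "cos (t - h) < 0" "cos (t + h) < 0"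
      using l u h cos_gt_zero_pi[of "pi - (t - h)"] cos_gt_zero_pi[of "pi - (t + h)"] by (simp_all add: cos_diff[of pi])
    then show False
      using rotated_cut_point[OF K \<omega>_root, of "\<xi>' - \<xi>"] A B pos cut by (simp add: mult_pos_neg)
  qed
qed

end

section \<open>Walk weights and potentials on graphs\<close>

fun walk_weight :: "('a \<Rightarrow> 'a \<Rightarrow> 'b::comm_monoid_mult) \<Rightarrow> 'a list \<Rightarrow> 'b" where
  "walk_weight r (x # y # zs) = r x y * walk_weight r (y # zs)"
| "walk_weight r _ = 1"

lemma walk_weight_append:
  "walk_weight r (xs @ v # ys) = walk_weight r (xs @ [v]) * walk_weight r (v # ys)"
proof (induction xs)
  case (Cons x xs)
  then show ?case by (cases xs) (auto simp: mult_ac)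
qed auto

lemma walk_weight_eq_prod:
  "walk_weight r (x # xs) = (\<Prod>t<length xs. r ((x # xs) ! t) (xs ! t))"
  by (induction xs arbitrary: x) (simp_all add: prod.lessThan_Suc_shift del: prod.lessThan_Suc)

text \<open>By induction on the length: at a repeated vertex \<open>v\<close> the walk splits into
  two shorter closed walks whose weights multiply to the given one.\<close>

lemma closed_walk_weight:
  assumes cyc: "\<And>ys. ys \<noteq> [] \<Longrightarrow> distinct ys \<Longrightarrow> successively J (ys @ [hd ys]) \<Longrightarrow>
      walk_weight r (ys @ [hd ys]) = 1"
    and xs: "xs \<noteq> []" "successively J xs" "hd xs = last xs"
  shows "walk_weight r xs = 1"
  using xs
proof (induction "length xs" arbitrary: xs rule: less_induct)
  case less
  obtain ys h where xs: "xs = ys @ [h]" using less.prems(1) by (metis rev_exhaust)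
  consider "ys = []" | "ys \<noteq> []" "distinct ys" | "\<not> distinct ys" by blast
  then show ?case
  proof cases
    case 1
    then show ?thesis by (simp add: xs)
  next
    case 2
    then have "h = hd ys" using less.prems(3) by (simp add: xs)
    then show ?thesis using cyc 2 less.prems(2) by (simp add: xs)
  next
    case 3
    then obtain as bs cs v where ys: "ys = as @ [v] @ bs @ [v] @ cs"
      using not_distinct_decomp by blast
    have "walk_weight r (v # bs @ [v]) = 1"
      by (rule less.hyps) (use less.prems(2) in \<open>auto simp: xs ys successively_append_iff successively_Cons hd_append split: if_splits\<close>)
    moreover have "walk_weight r (as @ v # cs @ [h]) = 1"
      by (rule less.hyps)
        (use less.prems(2,3) in \<open>auto simp: xs ys successively_append_iff successively_Cons hd_append split: if_splits\<close>)
    moreover have "walk_weight r xs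
        = walk_weight r (as @ [v]) * (walk_weight r (v # bs @ [v]) * walk_weight r (v # cs @ [h]))"
      using walk_weight_append[of r as v "bs @ v # cs @ [h]"] walk_weight_append[of r "v # bs" v "cs @ [h]"]
      by (simp add: xs ys)
    moreover have "walk_weight r (as @ v # cs @ [h]) = walk_weight r (as @ [v]) * walk_weight r (v # cs @ [h])"
      by (rule walk_weight_append)
    ultimately show ?thesis by simp
  qed
qed

text \<open>The value at \<open>i\<close> is the weight of any walk from \<open>i\<close> to
  \<open>v0\<close>. Closed walks of weight 1 make it independent of the walk, and prepending an
  edge gives the equation.\<close>

lemma potential_exists:
  fixes r :: "'a \<Rightarrow> 'a \<Rightarrow> 'b::field"
  assumes cyc: "\<And>ys. ys \<noteq> [] \<Longrightarrow> distinct ys \<Longrightarrow> successively J (ys @ [hd ys]) \<Longrightarrow>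
      walk_weight r (ys @ [hd ys]) = 1"
    and sym: "\<And>i j. J i j \<Longrightarrow> J j i"
    and conn: "\<And>i j. J i j \<Longrightarrow> J\<^sup>*\<^sup>* i v0"
  obtains g where "g v0 = 1" "\<And>i j. J i j \<Longrightarrow> g i = r i j * g j"
proof -
  define walk where "walk i xs \<longleftrightarrow> xs \<noteq> [] \<and> successively J xs \<and> hd xs = i \<and> last xs = v0" for i xs
  define g where "g i = walk_weight r (SOME xs. walk i xs)" for i
  have unique: "walk_weight r p = walk_weight r q" if "walk i p" "walk i q" for i p q
  proof -
    have closed: "walk_weight r p * walk_weight r (rev q) = 1" if pq: "walk i p" "walk i q" for p q
    proof -
      have last: "xs = butlast xs @ [v0]" if "walk i xs" for xs
        using append_butlast_last_id[of xs, symmetric] that unfolding walk_def by blast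
      obtain p' where p': "p = p' @ [v0]" using last[OF pq(1)] by blast
      obtain q' where q: "q = q' @ [v0]" using last[OF pq(2)] by blast
      then have q': "rev q = v0 # rev q'" by simp
      have "successively J q" using pq(2) by (simp add: walk_def)
      then have rev: "successively J (v0 # rev q')"
        unfolding q'[symmetric] successively_rev using sym by (auto simp: successively_conv_nth)
      have p: "successively J (p' @ [v0])" "hd (p' @ [v0]) = i" "hd (q' @ [v0]) = i"
        using pq by (auto simp: walk_def p' q)
      have "walk_weight r (p' @ v0 # rev q') = 1"
      proof (rule closed_walk_weight[where J = J])
        show "successively J (p' @ v0 # rev q')"
          using p(1) rev by (simp add: successively_append_iff)
        show "hd (p' @ v0 # rev q') = last (p' @ v0 # rev q')"
          using p(2,3) by (cases q') (auto simp: hd_append)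
      qed (simp_all add: cyc)
      then show ?thesis unfolding p' q' by (simp only: walk_weight_append[of r p' v0 "rev q'"])
    qed
    \<comment> \<open>Both weights are inverse to the weight of \<open>rev q\<close>.\<close>
    show ?thesis using closed[OF that] closed[OF that(2,2)] by (metis mult_cancel_right mult_zero_right zero_neq_one)
  qed
  have g: "g i = walk_weight r xs" if "walk i xs" for i xs
    unfolding g_def by (rule unique[OF someI[of "walk i"] that]) (rule that)
  have ex: "\<exists>xs. walk i xs" if "J\<^sup>*\<^sup>* i v0" for i
    using that
  proof (induction rule: converse_rtranclp_induct)
    case base
    show ?case by (rule exI[of _ "[v0]"]) (simp add: walk_def)
  next
    case (step y z)
    then obtain xs where "walk z xs" by blast
    then have "walk y (y # xs)" using step(1) by (auto simp: walk_def successively_Cons)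
    then show ?case by blast
  qed
  show ?thesis
  proof
    show "g v0 = 1" using g[of v0 "[v0]"] by (simp add: walk_def)
    fix i j assume ij: "J i j"
    obtain xs where xs: "walk j xs" using ex conn sym ij by blast
    then obtain ys where ys: "xs = j # ys" by (cases xs) (auto simp: walk_def)
    have "walk i (i # xs)" using xs ij by (auto simp: walk_def successively_Cons)
    then show "g i = r i j * g j" using g xs by (simp add: ys)
  qed
qed

section \<open>Cyclic shifts, rotated polygons and their centres\<close>

lemma bij_betw_Suc_mod: "bij_betw (\<lambda>t. Suc t mod n) {..<n} {..<n}"
proof -
  have inj: "inj_on (\<lambda>t. Suc t mod n) {..<n}"
    by (auto simp: inj_on_def mod_Suc split: if_splits)
  moreover have "(\<lambda>t. Suc t mod n) ` {..<n} \<subseteq> {..<n}" by auto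
  ultimately show ?thesis by (simp add: bij_betw_def endo_inj_surj)
qed

lemma rotation_convex_hull: "rotation p \<alpha> ` (convex hull S) = convex hull (rotation p \<alpha> ` S)"
proof -
  have eq: "rotation p \<alpha> ` T = (+) (p - cis \<alpha> * p) ` (*) (cis \<alpha>) ` T" for T
    unfolding image_image by (rule image_cong) (auto simp: rotation_def algebra_simps)
  show ?thesis
    unfolding eq convex_hull_translation
    by (subst convex_hull_linear_image) (auto intro: bounded_linear.linear bounded_linear_mult_right)
qed

text \<open>Each \<open>c + y\<close> lies in the ball of radius \<open>r\<close> about
  \<open>d\<close>. Summing the expanded squares over \<open>Y\<close> removes the cross terms,
  since \<open>Y\<close> has sum 0, and leaves
  \<open>card Y * (norm (c - d))\<^sup>2 \<le> 0\<close>.\<close>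

lemma convex_hull_center_unique:
  fixes X Y :: "'a::real_inner set"
  assumes Y: "finite Y" "Y \<noteq> {}" "\<Sum>Y = 0" "\<And>y. y \<in> Y \<Longrightarrow> norm y = r"
    and X: "\<And>x. x \<in> X \<Longrightarrow> norm x = r"
    and eq: "convex hull (+) c ` Y = convex hull (+) d ` X"
  shows "c = d"
proof -
  have "convex hull (+) d ` X \<subseteq> cball d r"
    by (rule hull_minimal) (auto simp: X dist_norm)
  then have "(+) c ` Y \<subseteq> cball d r" using hull_subset[of "(+) c ` Y" convex] eq by blast
  then have le: "norm ((c - d) + y) \<le> r" if "y \<in> Y" for y
    using that by (auto simp: dist_norm norm_minus_commute algebra_simps)
  have "(norm (c - d))\<^sup>2 + 2 * ((c - d) \<bullet> y) \<le> 0" if "y \<in> Y" for y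
  proof -
    have "(norm ((c - d) + y))\<^sup>2 \<le> r\<^sup>2" using le[OF that] by (intro power_mono) auto
    moreover have "y \<bullet> y = r\<^sup>2" using Y(4)[OF that] by (simp flip: power2_norm_eq_inner)
    ultimately show ?thesis by (simp add: power2_norm_eq_inner inner_add_left inner_add_right inner_commute)
  qed
  then have "(\<Sum>y\<in>Y. (norm (c - d))\<^sup>2 + 2 * ((c - d) \<bullet> y)) \<le> 0" by (intro sum_nonpos)
  also have "(\<Sum>y\<in>Y. (norm (c - d))\<^sup>2 + 2 * ((c - d) \<bullet> y)) = card Y * (norm (c - d))\<^sup>2 + 2 * ((c - d) \<bullet> \<Sum>Y)"
    by (simp add: sum.distrib inner_sum_right sum_distrib_left)
  finally have "card Y * (norm (c - d))\<^sup>2 \<le> 0" using Y(3) by simp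
  moreover have "card Y > 0" using Y by (simp add: card_gt_0_iff)
  ultimately show ?thesis by (auto simp: mult_le_0_iff)
qed

section \<open>The \<open>0\<close>-complexes of the first level\<close>

context nested_fractal
begin

definition cell :: "nat \<Rightarrow> complex set" where
  "cell i = (+) (L *\<^sub>R \<nu> i) ` K"

lemma unit_shift_mem: "i \<in> {1..N} \<Longrightarrow> L *\<^sub>R \<nu> i \<in> complex_shifts L N \<nu> K"
proof -
  assume i: "i \<in> {1..N}"
  have "(+) (L *\<^sub>R \<nu> i) ` K \<subseteq> unbounded_fractal L K"
  proof clarify
    fix z assume "z \<in> K"
    then have "L *\<^sub>R \<nu> i + z = L ^ 1 *\<^sub>R \<psi> i z" "\<psi> i z \<in> K"
      using i \<psi>_K by (auto simp: ifs_map_def algebra_simps)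
    then show "L *\<^sub>R \<nu> i + z \<in> unbounded_fractal L K" unfolding unbounded_fractal_def by blast
  qed
  then show ?thesis
    using i unfolding complex_shifts_def by (auto intro!: exI[of _ "1::nat"] exI[of _ "\<lambda>_. i"])
qed

text \<open>A complex has only one shift, so the defining union has a single term.\<close>

lemma complex_vertices_shift:
  "s \<in> complex_shifts L N \<nu> K \<Longrightarrow> complex_vertices L N \<nu> K ((+) s ` K) = (+) s ` V"
  using translate_compact_inj[OF K_compact K_nonempty]
  unfolding complex_vertices_def by blast

lemma cell_vertices:
  "i \<in> {1..N} \<Longrightarrow> complex_vertices L N \<nu> K (cell i) = (+) (L *\<^sub>R \<nu> i + b) ` X"
  unfolding cell_def
  by (subst complex_vertices_shift[OF unit_shift_mem]) (simp_all add: V_eq image_image add.assoc)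

lemma inj_cell: "inj_on cell {1..N}"
proof (rule inj_onI)
  fix i j assume ij: "i \<in> {1..N}" "j \<in> {1..N}" "cell i = cell j"
  then have "L *\<^sub>R \<nu> i = L *\<^sub>R \<nu> j"
    unfolding cell_def by (intro translate_compact_inj[OF K_compact K_nonempty])
  then show "i = j" using ij \<nu>_inj by (simp add: inj_on_eq_iff)
qed

lemma cell_eq: "cell i = (*\<^sub>R) L ` \<psi> i ` K"
  unfolding cell_def image_image by (rule image_cong) (auto simp: ifs_map_def algebra_simps)

lemma cells_intersect_iff: "cell i \<inter> cell j \<noteq> {} \<longleftrightarrow> \<psi> i ` K \<inter> \<psi> j ` K \<noteq> {}"
proof -
  have "inj ((*\<^sub>R) L :: complex \<Rightarrow> complex)" by (simp add: inj_on_def)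
  then show ?thesis unfolding cell_eq by (simp flip: image_Int)
qed

lemma sum_X: "\<Sum>X = 0"
proof -
  have "(\<Sum>v\<in>V. v) = (\<Sum>\<xi>\<in>X. b + \<xi>)" unfolding V_eq by (subst sum.reindex) (auto simp: inj_on_def)
  also have "\<dots> = of_nat k * b + \<Sum>X" by (simp add: sum.distrib X_card)
  finally show ?thesis using sum_V by simp
qed

lemma X_root_image: "u ^ k = 1 \<Longrightarrow> (*) u ` X = X"
  using X_root_mult finite_X k_ge by (intro endo_inj_surj) (auto simp: inj_on_def power_0_left)

end

section \<open>Ratios along cycles and rotation counts\<close>

context odd_nested_fractal
begin

definition joined :: "nat \<Rightarrow> nat \<Rightarrow> bool" where
  "joined i j \<longleftrightarrow> i \<in> {1..N} \<and> j \<in> {1..N} \<and> i \<noteq> j \<and> \<psi> i ` K \<inter> \<psi> j ` K \<noteq> {}"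

text \<open>Well defined for joined indices by \<open>common_vertex_unique\<close>.\<close>

definition ratio :: "nat \<Rightarrow> nat \<Rightarrow> complex" where
  "ratio i j = (THE q. \<exists>\<xi>\<in>X. \<exists>\<xi>'\<in>X. \<psi> i (b + \<xi>) = \<psi> j (b + \<xi>') \<and> q = \<xi>' / \<xi>)"

lemma ratio_eq:
  assumes ij: "i \<in> {1..N}" "j \<in> {1..N}" "i \<noteq> j"
    and X: "\<xi> \<in> X" "\<xi>' \<in> X" and eq: "\<psi> i (b + \<xi>) = \<psi> j (b + \<xi>')"
  shows "ratio i j = \<xi>' / \<xi>"
  unfolding ratio_def using X eq common_vertex_unique[OF ij X _ _ eq] by (intro the_equality) blast+

lemma joinedE:
  assumes "joined i j"
  obtains \<xi> \<xi>' where "i \<in> {1..N}" "j \<in> {1..N}" "i \<noteq> j" "\<xi> \<in> X" "\<xi>' \<in> X"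
    "\<psi> i (b + \<xi>) = \<psi> j (b + \<xi>')" "ratio i j = \<xi>' / \<xi>"
proof -
  have ij: "i \<in> {1..N}" "j \<in> {1..N}" "i \<noteq> j" using assms by (auto simp: joined_def)
  obtain z where "z \<in> \<psi> i ` K" "z \<in> \<psi> j ` K" using assms by (auto simp: joined_def)
  then obtain \<xi> \<xi>' where "\<xi> \<in> X" "\<xi>' \<in> X" "\<psi> i (b + \<xi>) = \<psi> j (b + \<xi>')"
    by (rule common_point_is_vertex[OF ij])
  then show ?thesis using that ij ratio_eq by blast
qed

lemma joinedI:
  assumes ij: "i \<in> {1..N}" "j \<in> {1..N}" "i \<noteq> j"
    and X: "\<xi> \<in> X" "\<xi>' \<in> X" and eq: "\<psi> i (b + \<xi>) = \<psi> j (b + \<xi>')"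
  shows "joined i j"
proof -
  have "b + \<xi> \<in> K" "b + \<xi>' \<in> K" using X V_sub_K by (auto simp: X_def)
  then show ?thesis using ij eq unfolding joined_def by blast
qed

lemma joined_sym: "joined i j \<Longrightarrow> joined j i"
  by (auto simp: joined_def)

lemma joined_connected:
  assumes "i \<in> {1..N}" "j \<in> {1..N}"
  shows "joined\<^sup>*\<^sup>* i j"
proof -
  have "(i, j) \<in> {(i, j). i \<in> {1..N} \<and> j \<in> {1..N} \<and> \<psi> i ` K \<inter> \<psi> j ` K \<noteq> {}}\<^sup>*"
    using index_connected assms .
  then show ?thesis
  proof (induction rule: rtrancl_induct)
    case (step y z)
    then have "y = z \<or> joined y z" by (auto simp: joined_def)
    then show ?case using step(3) by (metis rtranclp.rtrancl_into_rtrancl)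
  qed auto
qed

lemma adjacent_cell_iff:
  "i \<in> {1..N} \<Longrightarrow> j \<in> {1..N} \<Longrightarrow> adjacent (cell i) (cell j) \<longleftrightarrow> joined i j"
  using inj_cell cells_intersect_iff[of i j] by (auto simp: adjacent_def joined_def inj_on_eq_iff)

text \<open>The unique common vertex is the only possible pivot, and the convex hull determines the
  centre of a polygon; comparing centres fixes the factor.\<close>

lemma arises_by_rotation_cell_iff:
  assumes "joined i j"
  shows "arises_by_rotation L N \<nu> K \<alpha> (cell i) (cell j) \<longleftrightarrow> cis \<alpha> = ratio i j"
proof -
  obtain \<xi> \<xi>' where ij: "i \<in> {1..N}" "j \<in> {1..N}" "i \<noteq> j" and X: "\<xi> \<in> X" "\<xi>' \<in> X"
    and eq: "\<psi> i (b + \<xi>) = \<psi> j (b + \<xi>')" and r: "ratio i j = \<xi>' / \<xi>"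
    using assms by (rule joinedE)
  define c where "c i = L *\<^sub>R \<nu> i + b" for i
  have c_eq: "c i + \<eta> = c j + \<eta>' \<longleftrightarrow> \<psi> i (b + \<eta>) = \<psi> j (b + \<eta>')" for \<eta> \<eta>'
  proof -
    have "c i + \<eta> = of_real L * \<psi> i (b + \<eta>)" for i \<eta>
      by (simp add: c_def scaleR_conv_of_real \<psi>_eq distrib_left add_divide_distrib)
    then show ?thesis by simp
  qed
  have V: "complex_vertices L N \<nu> K (cell i) = (+) (c i) ` X" "complex_vertices L N \<nu> K (cell j) = (+) (c j) ` X"
    unfolding c_def using ij by (simp_all only: cell_vertices)
  have common: "(+) (c i) ` X \<inter> (+) (c j) ` X = {c i + \<xi>}"
  proof (rule equalityI; rule subsetI)
    fix p assume "p \<in> (+) (c i) ` X \<inter> (+) (c j) ` X"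
    then obtain \<eta> \<eta>' where "\<eta> \<in> X" "\<eta>' \<in> X" "p = c i + \<eta>" "c i + \<eta> = c j + \<eta>'" by auto
    then show "p \<in> {c i + \<xi>}" using common_vertex_unique[OF ij X _ _ eq] c_eq by blast
  next
    fix p assume "p \<in> {c i + \<xi>}"
    then show "p \<in> (+) (c i) ` X \<inter> (+) (c j) ` X" using X c_eq eq by auto
  qed
  have cj: "c j = c i + \<xi> - \<xi>'" using eq c_eq[of \<xi> \<xi>'] by (simp add: algebra_simps)
  have rot: "rotation (c i + \<xi>) \<alpha> ` (+) (c i) ` X = (+) (c i + \<xi> - cis \<alpha> * \<xi>) ` (*) (cis \<alpha>) ` X"
    unfolding image_image by (rule image_cong) (auto simp: rotation_def algebra_simps)
  have \<xi>0: "\<xi> \<noteq> 0" using X X_nonzero by blast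
  have "arises_by_rotation L N \<nu> K \<alpha> (cell i) (cell j) \<longleftrightarrow>
      convex hull (+) (c i + \<xi> - cis \<alpha> * \<xi>) ` (*) (cis \<alpha>) ` X = convex hull (+) (c j) ` X"
    unfolding arises_by_rotation_def V common rotation_convex_hull by (simp add: rot)
  also have "\<dots> \<longleftrightarrow> cis \<alpha> = \<xi>' / \<xi>"
  proof
    assume *: "convex hull (+) (c i + \<xi> - cis \<alpha> * \<xi>) ` (*) (cis \<alpha>) ` X = convex hull (+) (c j) ` X"
    \<comment> \<open>With \<open>cj\<close>, this equality of centres says that
      \<open>cis \<alpha> * \<xi> = \<xi>'\<close>.\<close>
    have "c i + \<xi> - cis \<alpha> * \<xi> = c j"
    proof (rule convex_hull_center_unique[OF _ _ _ _ _ *, of "norm \<xi>"])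
      have "\<Sum> ((*) (cis \<alpha>) ` X) = cis \<alpha> * \<Sum>X"
        by (subst sum.reindex) (auto simp: inj_on_def sum_distrib_left)
      then show "\<Sum> ((*) (cis \<alpha>) ` X) = 0" by (simp add: sum_X)
      show "norm x = norm \<xi>" if "x \<in> X" for x using X_norm[OF that X(1)] .
      then show "norm y = norm \<xi>" if "y \<in> (*) (cis \<alpha>) ` X" for y
        using that by (auto simp: norm_mult)
    qed (use X finite_X in auto)
    then show "cis \<alpha> = \<xi>' / \<xi>" using \<xi>0 by (simp add: cj field_simps)
  next
    assume *: "cis \<alpha> = \<xi>' / \<xi>"
    have "(*) (cis \<alpha>) ` X = X"
      unfolding * using X by (intro X_root_image X_ratio_root)
    moreover have "c i + \<xi> - cis \<alpha> * \<xi> = c j" using * \<xi>0 by (simp add: cj)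
    ultimately show "convex hull (+) (c i + \<xi> - cis \<alpha> * \<xi>) ` (*) (cis \<alpha>) ` X = convex hull (+) (c j) ` X"
      by simp
  qed
  finally show ?thesis by (simp only: r)
qed

definition index_cycle :: "nat list \<Rightarrow> bool" where
  "index_cycle xs \<longleftrightarrow> xs \<noteq> [] \<and> distinct xs \<and> (\<forall>t<length xs. joined (xs ! t) (xs ! (Suc t mod length xs)))"

lemma is_cycle_map_cell:
  assumes "set xs \<subseteq> {1..N}"
  shows "is_cycle L N \<nu> K (map cell xs) \<longleftrightarrow> index_cycle xs"
proof -
  have inj: "inj_on cell (set xs)" using inj_cell assms by (rule inj_on_subset)
  have mem: "xs ! t \<in> {1..N}" if "t < length xs" for t
    by (rule subsetD[OF assms nth_mem[OF that]])
  have "set (map cell xs) \<subseteq> unit_complexes L N \<nu> K"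
    using assms unfolding unit_complexes_def set_map cell_def by blast
  moreover have "adjacent (map cell xs ! t) (map cell xs ! (Suc t mod length xs))
      \<longleftrightarrow> joined (xs ! t) (xs ! (Suc t mod length xs))" if "t < length xs" for t
  proof -
    have "Suc t mod length xs < length xs" using that by (intro mod_less_divisor) auto
    then show ?thesis using that by (simp add: adjacent_cell_iff[OF mem mem])
  qed
  ultimately show ?thesis
    using inj by (auto simp: is_cycle_def index_cycle_def distinct_map)
qed

lemma is_cycle_imp_map_cell:
  assumes "is_cycle L N \<nu> K \<Delta>s"
  obtains xs where "set xs \<subseteq> {1..N}" "\<Delta>s = map cell xs"
proof -
  have "set \<Delta>s \<subseteq> cell ` {1..N}" using assms by (auto simp: is_cycle_def unit_complexes_def cell_def)
  then have "\<exists>xs. set xs \<subseteq> {1..N} \<and> \<Delta>s = map cell xs"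
  proof (induction \<Delta>s)
    case (Cons \<Delta> \<Delta>s)
    then obtain xs i where "set xs \<subseteq> {1..N}" "\<Delta>s = map cell xs" "i \<in> {1..N}" "\<Delta> = cell i" by auto
    then show ?case by (intro exI[of _ "i # xs"]) auto
  qed auto
  then show ?thesis using that by blast
qed

text \<open>Every factor is \<open>\<tau>\<close> or its inverse, so the product is a power of
  \<open>\<tau>\<close> with exponent the difference of the counts, and \<open>\<tau>\<close> has
  order \<open>k\<close>.\<close>

lemma cycle_rotation_count:
  assumes xs: "index_cycle xs"
  shows "(\<Prod>t<length xs. ratio (xs ! t) (xs ! (Suc t mod length xs))) = 1 \<longleftrightarrow>
    int k dvd int (rotation_count L N \<nu> K ((real k + 1) / real k * pi) (map cell xs))
      - int (rotation_count L N \<nu> K ((real k - 1) / real k * pi) (map cell xs))"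
proof -
  let ?n = "length xs"
  let ?q = "\<lambda>t. ratio (xs ! t) (xs ! (Suc t mod ?n))"
  have n: "?n > 0" using xs by (simp add: index_cycle_def)
  have count: "rotation_count L N \<nu> K \<alpha> (map cell xs) = card {t. t < ?n \<and> ?q t = cis \<alpha>}" for \<alpha>
  proof -
    have "arises_by_rotation L N \<nu> K \<alpha> (map cell xs ! t) (map cell xs ! (Suc t mod ?n)) \<longleftrightarrow> ?q t = cis \<alpha>"
      if "t < ?n" for t
      using arises_by_rotation_cell_iff[of "xs ! t" "xs ! (Suc t mod ?n)" \<alpha>] xs that n
      by (auto simp: index_cycle_def)
    then show ?thesis unfolding rotation_count_def by (intro arg_cong[where f = card]) auto
  qed
  define C D where "C = {t. t < ?n \<and> ?q t = \<tau>}" and "D = {t. t < ?n \<and> ?q t = \<tau>'}"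
  have "?q t = \<tau> \<or> ?q t = \<tau>'" if "t < ?n" for t
  proof -
    have "joined (xs ! t) (xs ! (Suc t mod ?n))" using xs that by (simp add: index_cycle_def)
    then obtain \<xi> \<xi>' where "xs ! t \<in> {1..N}" "xs ! (Suc t mod ?n) \<in> {1..N}"
      "xs ! t \<noteq> xs ! (Suc t mod ?n)" "\<xi> \<in> X" "\<xi>' \<in> X"
      "\<psi> (xs ! t) (b + \<xi>) = \<psi> (xs ! (Suc t mod ?n)) (b + \<xi>')" "?q t = \<xi>' / \<xi>" by (rule joinedE)
    then show ?thesis using common_vertex_ratio by simp
  qed
  then have un: "{..<?n} = C \<union> D" by (auto simp: C_def D_def)
  have "(\<Prod>t<?n. ?q t) = (\<Prod>t\<in>C. ?q t) * (\<Prod>t\<in>D. ?q t)"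
    unfolding un using \<tau>_neq by (intro prod.union_disjoint) (auto simp: C_def D_def)
  also have "(\<Prod>t\<in>C. ?q t) = \<tau> ^ card C" by (simp add: C_def)
  also have "(\<Prod>t\<in>D. ?q t) = \<tau>' ^ card D" by (simp add: D_def)
  finally have prod: "(\<Prod>t<?n. ?q t) = \<tau> ^ card C * \<tau>' ^ card D" .
  \<comment> \<open>Writing 1 in this form lets the powers of \<open>\<tau>'\<close> cancel without
    negative exponents.\<close>
  have inv: "\<tau> ^ card D * \<tau>' ^ card D = 1" by (simp only: \<tau>_mult power_one flip: power_mult_distrib)
  have "(\<Prod>t<?n. ?q t) = 1 \<longleftrightarrow> \<tau> ^ card C * \<tau>' ^ card D = \<tau> ^ card D * \<tau>' ^ card D"
    unfolding prod inv ..
  also have "\<dots> \<longleftrightarrow> \<tau> ^ card C = \<tau> ^ card D" by (simp only: mult_cancel_right) simp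
  also have "\<dots> \<longleftrightarrow> int k dvd int (card C) - int (card D)" by (rule \<tau>_power_eq_iff)
  finally show ?thesis unfolding count C_def D_def .
qed

lemma rotation_counts_iff_cycle_products:
  "(\<forall>\<Delta>s c d. is_cycle L N \<nu> K \<Delta>s \<and>
       c = rotation_count L N \<nu> K ((real k + 1) / real k * pi) \<Delta>s \<and>
       d = rotation_count L N \<nu> K ((real k - 1) / real k * pi) \<Delta>s \<longrightarrow>
       int k dvd (int c - int d)) \<longleftrightarrow>
    (\<forall>xs. index_cycle xs \<longrightarrow> (\<Prod>t<length xs. ratio (xs ! t) (xs ! (Suc t mod length xs))) = 1)"
  (is "?L \<longleftrightarrow> ?R")
proof
  assume L: ?L
  show ?R
  proof clarify
    fix xs assume xs: "index_cycle xs"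
    then have "set xs \<subseteq> {1..N}"
      by (auto simp: index_cycle_def in_set_conv_nth joined_def)
    then have "is_cycle L N \<nu> K (map cell xs)" using xs is_cycle_map_cell by blast
    then show "(\<Prod>t<length xs. ratio (xs ! t) (xs ! (Suc t mod length xs))) = 1"
      unfolding cycle_rotation_count[OF xs] using L by blast
  qed
next
  assume R: ?R
  show ?L
  proof clarify
    fix \<Delta>s assume cyc: "is_cycle L N \<nu> K \<Delta>s"
    then obtain xs where xs: "set xs \<subseteq> {1..N}" "\<Delta>s = map cell xs" by (rule is_cycle_imp_map_cell)
    then have "index_cycle xs" using cyc is_cycle_map_cell by blast
    then show "int k dvd int (rotation_count L N \<nu> K ((real k + 1) / real k * pi) \<Delta>s)
      - int (rotation_count L N \<nu> K ((real k - 1) / real k * pi) \<Delta>s)"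
      using R cycle_rotation_count xs(2) by blast
  qed
qed

lemma ratio_root: "joined i j \<Longrightarrow> ratio i j ^ k = 1"
  by (erule joinedE) (simp add: X_ratio_root)

section \<open>From a labelling to trivial cycle products\<close>

text \<open>The quotients telescope: the denominators are the numerators shifted cyclically.\<close>

lemma cycle_product_of_potential:
  assumes h: "\<And>i. i \<in> {1..N} \<Longrightarrow> h i \<noteq> 0" "\<And>i j. joined i j \<Longrightarrow> ratio i j = h i / h j"
    and xs: "index_cycle xs"
  shows "(\<Prod>t<length xs. ratio (xs ! t) (xs ! (Suc t mod length xs))) = 1"
proof -
  let ?n = "length xs"
  have mem: "xs ! t \<in> {1..N}" if "t < ?n" for t
    using xs that by (auto simp: index_cycle_def joined_def)
  have "(\<Prod>t<?n. ratio (xs ! t) (xs ! (Suc t mod ?n))) = (\<Prod>t<?n. h (xs ! t) / h (xs ! (Suc t mod ?n)))"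
    using xs h(2) by (intro prod.cong) (auto simp: index_cycle_def)
  also have "\<dots> = (\<Prod>t<?n. h (xs ! t)) / (\<Prod>t<?n. h (xs ! (Suc t mod ?n)))"
    by (rule prod_dividef)
  also have "(\<Prod>t<?n. h (xs ! (Suc t mod ?n))) = (\<Prod>t<?n. h (xs ! t))"
    by (rule prod.reindex_bij_betw[OF bij_betw_Suc_mod])
  also have "(\<Prod>t<?n. h (xs ! t)) / (\<Prod>t<?n. h (xs ! t)) = 1"
  proof -
    have "(\<Prod>t<?n. h (xs ! t)) \<noteq> 0" using h(1)[OF mem] by simp
    then show ?thesis by simp
  qed
  finally show ?thesis .
qed

lemma vertex_rotationE:
  assumes "R \<in> vertex_rotations L N \<nu>"
  obtains u where "u \<noteq> 0" "\<And>\<xi>. R (b + \<xi>) = b + u * \<xi>" "\<And>\<xi>. \<xi> \<in> X \<Longrightarrow> u * \<xi> \<in> X"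
proof -
  obtain \<alpha> where \<alpha>: "R = rotation b \<alpha>" "R ` V = V" using assms by (auto simp: vertex_rotations_def)
  have R: "R (b + \<xi>) = b + cis \<alpha> * \<xi>" for \<xi> by (simp add: \<alpha>(1) rotation_def)
  show ?thesis
  proof (rule that[OF _ R])
    fix \<xi> assume "\<xi> \<in> X"
    then have "R (b + \<xi>) \<in> V" using \<alpha>(2) by (auto simp: X_def)
    then show "cis \<alpha> * \<xi> \<in> X" by (simp add: R X_def)
  qed simp
qed

text \<open>A common vertex has one label, read through the rotations of both cells. Injectivity of
  the labels on \<open>V\<close> gives \<open>h i * \<xi> = h j * \<xi>'\<close>, so the ratios are
  quotients of \<open>h\<close>.\<close>

lemma labelling_imp_cycle_products:
  assumes "good_labelling_property L N \<nu> K A" and xs: "index_cycle xs"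
  shows "(\<Prod>t<length xs. ratio (xs ! t) (xs ! (Suc t mod length xs))) = 1"
proof -
  obtain l where l: "bij_betw l V A"
    "\<And>s. s \<in> complex_shifts L N \<nu> K \<Longrightarrow> \<exists>R\<in>vertex_rotations L N \<nu>.
       \<forall>v\<in>complex_vertices L N \<nu> K ((+) s ` K). l v = l (R (v - s))"
    using assms(1) unfolding good_labelling_property_def by blast
  have "\<exists>u. u \<noteq> 0 \<and> (\<forall>\<xi>\<in>X. u * \<xi> \<in> X \<and> l (of_real L * \<psi> i (b + \<xi>)) = l (b + u * \<xi>))" if i: "i \<in> {1..N}" for i
  proof -
    obtain R where R: "R \<in> vertex_rotations L N \<nu>"
      "\<And>v. v \<in> (+) (L *\<^sub>R \<nu> i) ` V \<Longrightarrow> l v = l (R (v - L *\<^sub>R \<nu> i))"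
      using l(2)[OF unit_shift_mem[OF i]] complex_vertices_shift[OF unit_shift_mem[OF i]] by metis
    obtain u where u: "u \<noteq> 0" "\<And>\<xi>. R (b + \<xi>) = b + u * \<xi>" "\<And>\<xi>. \<xi> \<in> X \<Longrightarrow> u * \<xi> \<in> X"
      using vertex_rotationE[OF R(1)] by metis
    have "l (of_real L * \<psi> i (b + \<xi>)) = l (b + u * \<xi>)" if "\<xi> \<in> X" for \<xi>
    proof -
      have "of_real L * \<psi> i (b + \<xi>) = L *\<^sub>R \<nu> i + (b + \<xi>)"
        by (simp add: \<psi>_eq scaleR_conv_of_real distrib_left add_divide_distrib)
      moreover have "L *\<^sub>R \<nu> i + (b + \<xi>) \<in> (+) (L *\<^sub>R \<nu> i) ` V" using that by (auto simp: X_def)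
      ultimately show ?thesis using R(2)[of "L *\<^sub>R \<nu> i + (b + \<xi>)"] by (simp add: u(2))
    qed
    then show ?thesis using u by blast
  qed
  then obtain h where h: "\<And>i. i \<in> {1..N} \<Longrightarrow> h i \<noteq> 0"
    "\<And>i \<xi>. i \<in> {1..N} \<Longrightarrow> \<xi> \<in> X \<Longrightarrow> h i * \<xi> \<in> X"
    "\<And>i \<xi>. i \<in> {1..N} \<Longrightarrow> \<xi> \<in> X \<Longrightarrow> l (of_real L * \<psi> i (b + \<xi>)) = l (b + h i * \<xi>)"
    by metis
  have "ratio i j = h i / h j" if ij: "joined i j" for i j
  proof -
    obtain \<xi> \<xi>' where ij: "i \<in> {1..N}" "j \<in> {1..N}" and X: "\<xi> \<in> X" "\<xi>' \<in> X"
      and eq: "\<psi> i (b + \<xi>) = \<psi> j (b + \<xi>')" and r: "ratio i j = \<xi>' / \<xi>"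
      using ij by (rule joinedE)
    have "l (b + h i * \<xi>) = l (b + h j * \<xi>')"
      using h(3)[OF ij(1) X(1)] h(3)[OF ij(2) X(2)] eq by simp
    moreover have "b + h i * \<xi> \<in> V" "b + h j * \<xi>' \<in> V" using h(2) ij X by (auto simp: X_def)
    ultimately have "h i * \<xi> = h j * \<xi>'" using l(1) by (auto simp: bij_betw_def inj_on_eq_iff)
    then show ?thesis
      unfolding r using X_nonzero[OF X(1)] h(1)[OF ij(2)] by (simp add: frac_eq_eq mult.commute)
  qed
  then show ?thesis using cycle_product_of_potential[of h] h(1) xs by blast
qed

section \<open>From trivial cycle products to a potential\<close>

lemma cycle_walk_weight:
  assumes "ys \<noteq> []" "distinct ys" "successively joined (ys @ [hd ys])"
  shows "index_cycle ys"
    "walk_weight ratio (ys @ [hd ys]) = (\<Prod>t<length ys. ratio (ys ! t) (ys ! (Suc t mod length ys)))"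
proof -
  obtain y zs where ys: "ys = y # zs" using assms(1) by (cases ys) auto
  have nth: "(ys @ [hd ys]) ! t = ys ! t" "(ys @ [hd ys]) ! Suc t = ys ! (Suc t mod length ys)" if "t < length ys" for t
  proof -
    show "(ys @ [hd ys]) ! t = ys ! t" using that by (simp add: nth_append)
    show "(ys @ [hd ys]) ! Suc t = ys ! (Suc t mod length ys)"
    proof (cases "Suc t = length ys")
      case True
      then show ?thesis by (simp add: nth_append ys)
    next
      case False
      then show ?thesis using that by (simp add: nth_append)
    qed
  qed
  have "joined (ys ! t) (ys ! (Suc t mod length ys))" if "t < length ys" for t
    using assms(3)[unfolded successively_conv_nth, rule_format, of t] that by (simp only: nth) simp
  then show "index_cycle ys" using assms(1,2) by (simp add: index_cycle_def)
  have "walk_weight ratio (ys @ [hd ys]) = (\<Prod>t<length ys. ratio ((ys @ [hd ys]) ! t) ((ys @ [hd ys]) ! Suc t))"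
    using walk_weight_eq_prod[of ratio y "zs @ [y]"] by (simp add: ys del: prod.lessThan_Suc)
  also have "\<dots> = (\<Prod>t<length ys. ratio (ys ! t) (ys ! (Suc t mod length ys)))"
    by (intro prod.cong) (simp_all add: nth del: nth_append)
  finally show "walk_weight ratio (ys @ [hd ys]) = (\<Prod>t<length ys. ratio (ys ! t) (ys ! (Suc t mod length ys)))" .
qed

text \<open>Rotating each cell \<open>i\<close> by \<open>g i\<close> makes the labels at common
  vertices agree; the root condition keeps the rotated vertices in \<open>X\<close>.\<close>

definition potential :: "(nat \<Rightarrow> complex) \<Rightarrow> bool" where
  "potential g \<longleftrightarrow> (\<forall>i\<in>{1..N}. g i ^ k = 1) \<and>
     (\<forall>i\<in>{1..N}. \<forall>j\<in>{1..N}. \<forall>\<xi>\<in>X. \<forall>\<xi>'\<in>X. \<psi> i (b + \<xi>) = \<psi> j (b + \<xi>') \<longrightarrow> g i * \<xi> = g j * \<xi>')"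

text \<open>The walk potential based at \<open>v0\<close> works: all ratios are roots of unity, so
  this property spreads from \<open>g v0 = 1\<close> along chains of joined cells.\<close>

lemma cycle_products_imp_potential:
  assumes cyc: "\<And>xs. index_cycle xs \<Longrightarrow>
      (\<Prod>t<length xs. ratio (xs ! t) (xs ! (Suc t mod length xs))) = 1"
    and v0: "v0 \<in> {1..N}"
  obtains g where "potential g" "g v0 = 1"
proof -
  obtain g where g: "g v0 = 1" "\<And>i j. joined i j \<Longrightarrow> g i = ratio i j * g j"
  proof (rule potential_exists[of joined ratio v0])
    show "walk_weight ratio (ys @ [hd ys]) = 1"
      if "ys \<noteq> []" "distinct ys" "successively joined (ys @ [hd ys])" for ys
      using cycle_walk_weight[OF that] cyc by simp
    show "joined\<^sup>*\<^sup>* i v0" if "joined i j" for i j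
      using that v0 by (intro joined_connected) (auto simp: joined_def)
  qed (use joined_sym in blast)+
  have root: "g i ^ k = 1" if "i \<in> {1..N}" for i
  proof -
    have "joined\<^sup>*\<^sup>* v0 i" using v0 that by (rule joined_connected)
    then show ?thesis
    proof (induction rule: rtranclp_induct)
      case (step y z)
      then have "g y ^ k = ratio y z ^ k * g z ^ k" using g(2) by (simp add: power_mult_distrib)
      then show ?case using step ratio_root by simp
    qed (simp add: g(1))
  qed
  have "g i * \<xi> = g j * \<xi>'"
    if "i \<in> {1..N}" "j \<in> {1..N}" "\<xi> \<in> X" "\<xi>' \<in> X" "\<psi> i (b + \<xi>) = \<psi> j (b + \<xi>')" for i j \<xi> \<xi>'
  proof (cases "i = j")
    case False
    have "joined i j" "ratio i j = \<xi>' / \<xi>" using joinedI ratio_eq that False by blast+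
    then show ?thesis using g(2) X_nonzero[OF that(3)] by simp
  qed (use that in simp)
  then have "potential g" unfolding potential_def using root by blast
  then show ?thesis using g(1) by (rule that)
qed

section \<open>Extending a potential to words of any length\<close>

text \<open>The rotation by \<open>\<omega>\<close> permutes the cells and preserves all ratios, so it multiplies
  the potential by a constant root of unity \<open>\<omega> ^ \<delta>\<close>; this determines the potential on the
  corner cells.\<close>

lemma potential_corner:
  assumes g: "potential g"
  obtains c \<delta> \<kappa> where "\<And>\<xi>. \<xi> \<in> X \<Longrightarrow> \<kappa> \<xi> \<in> {1..N}" "\<And>\<xi>. \<xi> \<in> X \<Longrightarrow> \<psi> (\<kappa> \<xi>) (b + \<xi>) = b + \<xi>"
    "\<And>\<xi>. \<xi> \<in> X \<Longrightarrow> g (\<kappa> \<xi>) = c * \<xi> ^ \<delta>"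
proof -
  have root: "\<And>i. i \<in> {1..N} \<Longrightarrow> g i ^ k = 1"
    and pot: "\<And>i j \<xi> \<xi>'. i \<in> {1..N} \<Longrightarrow> j \<in> {1..N} \<Longrightarrow> \<xi> \<in> X \<Longrightarrow> \<xi>' \<in> X \<Longrightarrow>
      \<psi> i (b + \<xi>) = \<psi> j (b + \<xi>') \<Longrightarrow> g i * \<xi> = g j * \<xi>'"
    using g unfolding potential_def by blast+
  have gnz: "g i \<noteq> 0" if "i \<in> {1..N}" for i using root[OF that] k_ge by (auto simp: power_0_left)
  have "\<forall>i\<in>{1..N}. \<exists>j. j \<in> {1..N} \<and> (\<forall>z. rot \<omega> (\<psi> i z) = \<psi> j (rot \<omega> z))"
    using rot_intertwines[OF \<omega>_root] by blast
  then obtain \<rho> where \<rho>: "\<And>i. i \<in> {1..N} \<Longrightarrow> \<rho> i \<in> {1..N}"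
    "\<And>i z. i \<in> {1..N} \<Longrightarrow> rot \<omega> (\<psi> i z) = \<psi> (\<rho> i) (rot \<omega> z)" by metis
  have rotb: "rot \<omega> (b + \<xi>) = b + \<omega> * \<xi>" for \<xi> by (simp add: rot_def)
  obtain v0 where v0: "v0 \<in> {1..N}" using ex_zero by blast
  define \<epsilon> where "\<epsilon> = g (\<rho> v0) / g v0"
  have \<epsilon>: "g (\<rho> i) = \<epsilon> * g i" if "i \<in> {1..N}" for i
  proof -
    have "joined\<^sup>*\<^sup>* v0 i" using v0 that by (rule joined_connected)
    then show ?thesis
    proof (induction rule: rtranclp_induct)
      case base
      then show ?case using gnz[OF v0] by (simp add: \<epsilon>_def)
    next
      case (step i j)
      obtain \<xi> \<xi>' where ij: "i \<in> {1..N}" "j \<in> {1..N}" and X: "\<xi> \<in> X" "\<xi>' \<in> X"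
        and eq: "\<psi> i (b + \<xi>) = \<psi> j (b + \<xi>')" using step(2) by (rule joinedE)
      have "\<psi> (\<rho> i) (b + \<omega> * \<xi>) = \<psi> (\<rho> j) (b + \<omega> * \<xi>')"
        using \<rho>(2)[OF ij(1), of "b + \<xi>"] \<rho>(2)[OF ij(2), of "b + \<xi>'"] eq by (simp only: rotb)
      then have "g (\<rho> i) * (\<omega> * \<xi>) = g (\<rho> j) * (\<omega> * \<xi>')"
        using ij X by (intro pot \<rho>(1) X_root_mult[OF \<omega>_root])
      then have "\<epsilon> * (g i * \<xi>) = g (\<rho> j) * \<xi>'" using step(3) by simp
      then show ?case using pot[OF ij X eq] X_nonzero[OF X(2)] by simp
    qed
  qed
  have "\<epsilon> ^ k = 1"
    unfolding \<epsilon>_def using root v0 \<rho>(1) by (simp add: power_divide)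
  then obtain \<delta> where \<delta>: "\<epsilon> = \<omega> ^ \<delta>" by (rule root_eq_\<omega>_power)
  have "\<forall>\<xi>\<in>X. \<exists>i. i \<in> {1..N} \<and> \<psi> i (b + \<xi>) = b + \<xi>"
    by (auto simp: X_def essential_fixed_points_def fixed_points_def)
  then obtain \<kappa> where \<kappa>: "\<And>\<xi>. \<xi> \<in> X \<Longrightarrow> \<kappa> \<xi> \<in> {1..N}" "\<And>\<xi>. \<xi> \<in> X \<Longrightarrow> \<psi> (\<kappa> \<xi>) (b + \<xi>) = b + \<xi>"
    by metis
  \<comment> \<open>A corner cell is the only cell whose map fixes its vertex, so the rotation
    carries corner cells to corner cells.\<close>
  have \<kappa>_rot: "\<kappa> (\<omega> * \<xi>) = \<rho> (\<kappa> \<xi>)" if "\<xi> \<in> X" for \<xi>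
  proof -
    have X: "\<omega> * \<xi> \<in> X" using that by (rule X_root_mult[OF \<omega>_root])
    have "\<psi> (\<rho> (\<kappa> \<xi>)) (b + \<omega> * \<xi>) = b + \<omega> * \<xi>"
      using \<rho>(2)[OF \<kappa>(1)[OF that], of "b + \<xi>"] by (simp only: \<kappa>(2)[OF that] rotb)
    then show ?thesis
      using \<psi>_index_eq[OF \<kappa>(1)[OF X] \<rho>(1)[OF \<kappa>(1)[OF that]]] \<kappa>(2)[OF X] by metis
  qed
  obtain \<xi>0 where \<xi>0: "\<xi>0 \<in> X" using X_ex_other by blast
  have pow: "\<omega> ^ n * \<xi>0 \<in> X \<and> g (\<kappa> (\<omega> ^ n * \<xi>0)) = \<epsilon> ^ n * g (\<kappa> \<xi>0)" for n
  proof (induction n)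
    case (Suc n)
    have eq: "\<omega> ^ Suc n * \<xi>0 = \<omega> * (\<omega> ^ n * \<xi>0)" by simp
    have "g (\<kappa> (\<omega> ^ Suc n * \<xi>0)) = \<epsilon> * g (\<kappa> (\<omega> ^ n * \<xi>0))"
      unfolding eq using Suc by (simp only: \<kappa>_rot \<epsilon>[OF \<kappa>(1)])
    then show ?case unfolding eq using Suc X_root_mult[OF \<omega>_root] by simp
  qed (simp add: \<xi>0)
  \<comment> \<open>Going from \<open>\<xi>0\<close> to \<open>\<omega> ^ n * \<xi>0\<close>
    multiplies the corner value by \<open>\<epsilon> ^ n\<close>, which equals
    \<open>(\<xi> / \<xi>0) ^ \<delta>\<close>.\<close>
  have "g (\<kappa> \<xi>) = g (\<kappa> \<xi>0) / \<xi>0 ^ \<delta> * \<xi> ^ \<delta>" if \<xi>X: "\<xi> \<in> X" for \<xi>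
  proof -
    obtain n where n: "\<xi> / \<xi>0 = \<omega> ^ n" by (rule root_eq_\<omega>_power[OF X_ratio_root[OF \<xi>X \<xi>0]])
    then have \<xi>: "\<xi> = \<omega> ^ n * \<xi>0" using X_nonzero[OF \<xi>0] by (simp add: field_simps)
    have "g (\<kappa> \<xi>) = (\<omega> ^ \<delta>) ^ n * g (\<kappa> \<xi>0)" using pow[of n] unfolding \<delta> \<xi> by blast
    also have "(\<omega> ^ \<delta>) ^ n = (\<omega> ^ n) ^ \<delta>" by (simp only: mult.commute flip: power_mult)
    also have "\<omega> ^ n = \<xi> / \<xi>0" by (simp only: n)
    finally show ?thesis by (simp add: power_divide)
  qed
  with \<kappa> show ?thesis
    by (intro that[where \<kappa> = \<kappa> and c = "g (\<kappa> \<xi>0) / \<xi>0 ^ \<delta>" and \<delta> = \<delta>])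
qed

definition shift :: "nat \<Rightarrow> (nat \<Rightarrow> nat) \<Rightarrow> complex" where
  "shift J w = (\<Sum>j=1..J. L ^ j *\<^sub>R \<nu> (w j))"

lemma shift_0 [simp]: "shift 0 w = 0"
  and shift_Suc [simp]: "shift (Suc J) w = shift J w + L ^ Suc J *\<^sub>R \<nu> (w (Suc J))"
  by (simp_all add: shift_def)

text \<open>Each further letter applies a cell map and rescales, as \<open>L ^ Suc J\<close> times
  \<open>\<psi> i y\<close> is \<open>L ^ J * y\<close> plus the new summand.\<close>

lemma shift_in_scaled_K:
  assumes "\<And>j. j \<in> {1..J} \<Longrightarrow> w j \<in> {1..N}" "z \<in> K"
  obtains y where "y \<in> K" "shift J w + z = of_real L ^ J * y"
  using assms
proof (induction J arbitrary: thesis)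
  case (Suc J)
  obtain y where y: "y \<in> K" "shift J w + z = of_real L ^ J * y"
    using Suc.IH Suc.prems by auto
  have "w (Suc J) \<in> {1..N}" using Suc.prems(2)[of "Suc J"] by simp
  moreover have "shift (Suc J) w + z = (shift J w + z) + L ^ Suc J *\<^sub>R \<nu> (w (Suc J))" by simp
  then have "shift (Suc J) w + z = of_real L ^ Suc J * \<psi> (w (Suc J)) y"
    by (simp add: y(2) \<psi>_eq scaleR_conv_of_real distrib_left)
  ultimately show ?case using Suc.prems(1) \<psi>_K y(1) by blast
qed auto

text \<open>If \<open>x\<close> is a vertex, the constant word describes the complex at the corner
  \<open>L ^ J * x\<close> of the fractal enlarged by \<open>L ^ J\<close>.\<close>

lemma shift_const:
  assumes "\<psi> i x = x"
  shows "shift J (\<lambda>_. i) + x = of_real L ^ J * x"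
proof (induction J)
  case (Suc J)
  have "shift (Suc J) (\<lambda>_. i) + x = (shift J (\<lambda>_. i) + x) + L ^ Suc J *\<^sub>R \<nu> i" by simp
  also have "\<dots> = of_real L ^ Suc J * \<psi> i x"
    by (simp add: Suc \<psi>_eq scaleR_conv_of_real distrib_left)
  finally show ?case by (simp add: assms)
qed simp

text \<open>Letters are numbered from 1, so the first one has exponent \<open>m ^ 0 = 1\<close> and
  the weight of a one-letter word is its value under \<open>g\<close>.\<close>

definition word_weight :: "(nat \<Rightarrow> complex) \<Rightarrow> nat \<Rightarrow> nat \<Rightarrow> (nat \<Rightarrow> nat) \<Rightarrow> complex" where
  "word_weight g m J w = (\<Prod>j=1..J. g (w j) ^ m ^ (j - 1))"

lemma word_weight_0 [simp]: "word_weight g m 0 w = 1"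
  and word_weight_Suc [simp]: "word_weight g m (Suc J) w = word_weight g m J w * g (w (Suc J)) ^ m ^ J"
  by (simp_all add: word_weight_def)

lemma word_weight_const: "word_weight g m J (\<lambda>_. i) = g i ^ (\<Sum>t<J. m ^ t)"
  by (induction J) (simp_all add: power_add)

text \<open>The geometric sum for \<open>m = Suc \<delta>\<close>; it collects the exponents of
  \<open>\<eta>\<close> in the weight of a constant corner word, times
  \<open>\<eta>\<close>.\<close>

lemma sum_powers_Suc: "\<delta> * (\<Sum>t<J. Suc \<delta> ^ t) + 1 = Suc \<delta> ^ J"
  by (induction J) (simp_all add: algebra_simps)

text \<open>If the last letters of the two words differ, the common vertex is a corner of the two
  complexes of level \<open>J\<close>, so that each of the two shorter words may be replaced by a constant one,
  for which the weight is known explicitly. The exponent \<open>m = Suc \<delta>\<close> is chosen so that this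
  weight, times \<open>\<eta>\<close>, is a constant multiple of \<open>\<eta> ^ m ^ J\<close>.\<close>

lemma potential_word_weight:
  assumes g: "potential g"
  obtains m where "\<And>J w w' \<xi> \<xi>'. (\<And>j. j \<in> {1..J} \<Longrightarrow> w j \<in> {1..N}) \<Longrightarrow> (\<And>j. j \<in> {1..J} \<Longrightarrow> w' j \<in> {1..N}) \<Longrightarrow>
    \<xi> \<in> X \<Longrightarrow> \<xi>' \<in> X \<Longrightarrow> shift J w + \<xi> = shift J w' + \<xi>' \<Longrightarrow>
    word_weight g m J w * \<xi> = word_weight g m J w' * \<xi>'"
proof -
  obtain c \<delta> \<kappa> where \<kappa>: "\<And>\<xi>. \<xi> \<in> X \<Longrightarrow> \<kappa> \<xi> \<in> {1..N}" "\<And>\<xi>. \<xi> \<in> X \<Longrightarrow> \<psi> (\<kappa> \<xi>) (b + \<xi>) = b + \<xi>"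
    "\<And>\<xi>. \<xi> \<in> X \<Longrightarrow> g (\<kappa> \<xi>) = c * \<xi> ^ \<delta>"
    by (rule potential_corner[OF g]) blast
  define m where "m = Suc \<delta>"
  have corner: "word_weight g m J (\<lambda>_. \<kappa> \<eta>) * \<eta> = c ^ (\<Sum>t<J. m ^ t) * \<eta> ^ m ^ J" if "\<eta> \<in> X" for \<eta> J
  proof -
    have "word_weight g m J (\<lambda>_. \<kappa> \<eta>) * \<eta> = c ^ (\<Sum>t<J. m ^ t) * \<eta> ^ (\<delta> * (\<Sum>t<J. m ^ t) + 1)"
      by (simp add: word_weight_const \<kappa>(3)[OF that] power_mult_distrib power_mult)
    then show ?thesis by (simp only: m_def sum_powers_Suc)
  qed
  have "word_weight g m J w * \<xi> = word_weight g m J w' * \<xi>'"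
    if "\<And>j. j \<in> {1..J} \<Longrightarrow> w j \<in> {1..N}" "\<And>j. j \<in> {1..J} \<Longrightarrow> w' j \<in> {1..N}"
      "\<xi> \<in> X" "\<xi>' \<in> X" "shift J w + \<xi> = shift J w' + \<xi>'" for J w w' \<xi> \<xi>'
    using that
  proof (induction J arbitrary: w w' \<xi> \<xi>')
    case (Suc J)
    define i j where "i = w (Suc J)" and "j = w' (Suc J)"
    have ij: "i \<in> {1..N}" "j \<in> {1..N}" using Suc.prems(1,2)[of "Suc J"] by (auto simp: i_def j_def)
    have w: "\<And>j. j \<in> {1..J} \<Longrightarrow> w j \<in> {1..N}" "\<And>j. j \<in> {1..J} \<Longrightarrow> w' j \<in> {1..N}"
      using Suc.prems(1,2) by auto
    show ?case
    proof (cases "i = j")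
      case True
      then have "shift J w + \<xi> = shift J w' + \<xi>'" using Suc.prems(5) by (simp add: i_def j_def)
      then have "word_weight g m J w * \<xi> = word_weight g m J w' * \<xi>'"
        using Suc.prems(3,4) w by (intro Suc.IH)
      then show ?thesis using True by (simp add: i_def j_def)
    next
      case False
      have K: "b + \<xi> \<in> K" "b + \<xi>' \<in> K" using Suc.prems(3,4) V_sub_K by (auto simp: X_def)
      obtain y where y: "y \<in> K" "shift J w + (b + \<xi>) = of_real L ^ J * y"
        by (rule shift_in_scaled_K[OF w(1) K(1)])
      obtain y' where y': "y' \<in> K" "shift J w' + (b + \<xi>') = of_real L ^ J * y'"
        by (rule shift_in_scaled_K[OF w(2) K(2)])
      \<comment> \<open>Scaled down by \<open>L ^ Suc J\<close>, the common vertex becomes a point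
        of both cells \<open>i\<close> and \<open>j\<close>, so nesting makes \<open>y\<close> and
        \<open>y'\<close> vertices of \<open>K\<close>.\<close>
      have "of_real L ^ Suc J * \<psi> i y = of_real L ^ Suc J * \<psi> j y'"
      proof -
        have "of_real L ^ Suc J * \<psi> i y = of_real L ^ J * y + L ^ Suc J *\<^sub>R \<nu> i" for i y
          by (simp add: \<psi>_eq scaleR_conv_of_real distrib_left)
        note scale = this
        have "of_real L ^ Suc J * \<psi> i y = b + (shift (Suc J) w + \<xi>)"
          unfolding scale y(2)[symmetric] by (simp add: i_def)
        also have "\<dots> = of_real L ^ Suc J * \<psi> j y'"
          unfolding scale y'(2)[symmetric] Suc.prems(5) by (simp add: j_def)
        finally show ?thesis .
      qed
      then have eq: "\<psi> i y = \<psi> j y'" by simp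
      then have "\<psi> i y \<in> \<psi> i ` K" "\<psi> i y \<in> \<psi> j ` K" using y(1) y'(1) by blast+
      then obtain \<eta> \<eta>' where \<eta>: "\<eta> \<in> X" "\<eta>' \<in> X" "\<psi> i y = \<psi> i (b + \<eta>)" "\<psi> i (b + \<eta>) = \<psi> j (b + \<eta>')"
        by (rule common_point_is_vertex[OF ij False])
      have y\<eta>: "y = b + \<eta>" using \<eta>(3) by (simp only: \<psi>_eq_iff)
      have "\<psi> j y' = \<psi> j (b + \<eta>')" using \<eta>(3,4) eq by metis
      then have y\<eta>': "y' = b + \<eta>'" by (simp only: \<psi>_eq_iff)
      have reduce: "word_weight g m J v * \<zeta> = c ^ (\<Sum>t<J. m ^ t) * \<theta> ^ m ^ J"
        if "\<And>j. j \<in> {1..J} \<Longrightarrow> v j \<in> {1..N}" "\<zeta> \<in> X" "\<theta> \<in> X"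
          "shift J v + (b + \<zeta>) = of_real L ^ J * (b + \<theta>)" for v \<zeta> \<theta>
      proof -
        have "shift J v + (b + \<zeta>) = shift J (\<lambda>_. \<kappa> \<theta>) + (b + \<theta>)"
          unfolding that(4) shift_const[OF \<kappa>(2)[OF that(3)]] ..
        then have "shift J v + \<zeta> = shift J (\<lambda>_. \<kappa> \<theta>) + \<theta>" by (simp add: algebra_simps)
        then have "word_weight g m J v * \<zeta> = word_weight g m J (\<lambda>_. \<kappa> \<theta>) * \<theta>"
          using that \<kappa>(1) by (intro Suc.IH)
        then show ?thesis by (simp only: corner[OF that(3)])
      qed
      have 1: "word_weight g m J w * \<xi> = c ^ (\<Sum>t<J. m ^ t) * \<eta> ^ m ^ J"
        using y(2) unfolding y\<eta> by (intro reduce w Suc.prems \<eta>)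
      have 2: "word_weight g m J w' * \<xi>' = c ^ (\<Sum>t<J. m ^ t) * \<eta>' ^ m ^ J"
        using y'(2) unfolding y\<eta>' by (intro reduce w Suc.prems \<eta>)
      have 3: "g i * \<eta> = g j * \<eta>'" using g ij \<eta> unfolding potential_def by blast
      have "word_weight g m (Suc J) w * \<xi> = (word_weight g m J w * \<xi>) * g i ^ m ^ J"
        by (simp add: i_def)
      also have "\<dots> = c ^ (\<Sum>t<J. m ^ t) * (g i * \<eta>) ^ m ^ J"
        unfolding 1 by (simp add: power_mult_distrib)
      also have "\<dots> = c ^ (\<Sum>t<J. m ^ t) * (g j * \<eta>') ^ m ^ J"
        unfolding 3 ..
      also have "\<dots> = (word_weight g m J w' * \<xi>') * g j ^ m ^ J"
        unfolding 2 by (simp add: power_mult_distrib)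
      also have "\<dots> = word_weight g m (Suc J) w' * \<xi>'" by (simp add: j_def)
      finally show ?thesis .
    qed
  qed simp
  then show ?thesis by (rule that)
qed

section \<open>The labelling built from a potential\<close>

text \<open>The vertex \<open>s + (b + \<xi>)\<close> gets the label of \<open>u * \<xi>\<close>,
  where \<open>u\<close> is the weight of any word for \<open>s\<close>;
  \<open>potential_word_weight\<close> makes this consistent.\<close>

lemma potential_imp_labelling:
  assumes g: "potential g" and v0: "v0 \<in> {1..N}" "\<nu> v0 = 0" "g v0 = 1"
    and A: "finite A" "card A = k"
  shows "good_labelling_property L N \<nu> K A"
proof -
  obtain m where m: "\<And>J w w' \<xi> \<xi>'. (\<And>j. j \<in> {1..J} \<Longrightarrow> w j \<in> {1..N}) \<Longrightarrow> (\<And>j. j \<in> {1..J} \<Longrightarrow> w' j \<in> {1..N}) \<Longrightarrow>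
    \<xi> \<in> X \<Longrightarrow> \<xi>' \<in> X \<Longrightarrow> shift J w + \<xi> = shift J w' + \<xi>' \<Longrightarrow>
    word_weight g m J w * \<xi> = word_weight g m J w' * \<xi>'"
    by (rule potential_word_weight[OF g]) blast
  define rep where "rep s u \<longleftrightarrow> (\<exists>J w. (\<forall>j\<in>{1..J}. w j \<in> {1..N}) \<and> s = shift J w \<and> u = word_weight g m J w)" for s u
  \<comment> \<open>Appending letters \<open>v0\<close> changes neither shift nor weight, since
    \<open>\<nu> v0 = 0\<close> and \<open>g v0 = 1\<close>; words of different lengths become
    comparable.\<close>
  have pad: "\<exists>w'. (\<forall>j\<in>{1..M}. w' j \<in> {1..N}) \<and> shift M w' = shift J w \<and> word_weight g m M w' = word_weight g m J w"
    if "\<forall>j\<in>{1..J}. w j \<in> {1..N}" "J \<le> M" for J M w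
    using that(2,1)
  proof (induction M rule: dec_induct)
    case (step M)
    then obtain w' where w': "\<forall>j\<in>{1..M}. w' j \<in> {1..N}" "shift M w' = shift J w"
      "word_weight g m M w' = word_weight g m J w" by blast
    define w'' where "w'' = w'(Suc M := v0)"
    have "shift M w'' = shift M w'" "word_weight g m M w'' = word_weight g m M w'"
      by (auto simp: shift_def word_weight_def w''_def intro!: sum.cong prod.cong)
    then have "shift (Suc M) w'' = shift J w" "word_weight g m (Suc M) w'' = word_weight g m J w"
      using w'(2,3) v0 by (simp_all add: w''_def)
    moreover have "\<forall>j\<in>{1..Suc M}. w'' j \<in> {1..N}" using w'(1) v0(1) by (auto simp: w''_def)
    ultimately show ?case by blast
  qed blast
  have unique: "u * \<xi> = u' * \<xi>'" if reps: "rep s u" "rep s' u'" and X: "\<xi> \<in> X" "\<xi>' \<in> X" and eq: "s + \<xi> = s' + \<xi>'"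
    for s s' u u' \<xi> \<xi>'
  proof -
    obtain J w where w: "\<forall>j\<in>{1..J}. w j \<in> {1..N}" "s = shift J w" "u = word_weight g m J w"
      using reps(1) unfolding rep_def by blast
    obtain J' w' where w': "\<forall>j\<in>{1..J'}. w' j \<in> {1..N}" "s' = shift J' w'" "u' = word_weight g m J' w'"
      using reps(2) unfolding rep_def by blast
    obtain v where v: "\<forall>j\<in>{1..max J J'}. v j \<in> {1..N}" "shift (max J J') v = s" "word_weight g m (max J J') v = u"
      using pad[OF w(1), of "max J J'"] w by auto
    obtain v' where v': "\<forall>j\<in>{1..max J J'}. v' j \<in> {1..N}" "shift (max J J') v' = s'" "word_weight g m (max J J') v' = u'"
      using pad[OF w'(1), of "max J J'"] w' by auto
    show ?thesis using m[of "max J J'" v v' \<xi> \<xi>'] v v' X eq by blast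
  qed
  have rep_root: "u ^ k = 1" if u: "rep s u" for s u
  proof -
    obtain J w where w: "\<forall>j\<in>{1..J}. w j \<in> {1..N}" "u = word_weight g m J w"
      using u unfolding rep_def by blast
    have "(g (w j) ^ e) ^ k = 1" if "j \<in> {1..J}" for j e
      using g w(1) that unfolding potential_def by (metis mult.commute power_mult power_one)
    then show ?thesis unfolding w(2) word_weight_def by (simp add: prod_power_distrib)
  qed
  have rep_shift: "\<exists>u. rep s u" if "s \<in> complex_shifts L N \<nu> K" for s
    using that unfolding complex_shifts_def rep_def shift_def by blast
  \<comment> \<open>The empty word, allowed in \<open>rep\<close>, represents the original complex
    with weight 1, so \<open>val\<close> is the identity on \<open>X\<close> up to the translation
    by \<open>b\<close>.\<close>
  have rep_0: "rep 0 1" unfolding rep_def by (rule exI[of _ 0]) simp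
  define val where "val v = (SOME y. \<exists>s u \<xi>. rep s u \<and> \<xi> \<in> X \<and> v = s + (b + \<xi>) \<and> y = u * \<xi>)" for v
  have val: "val (s + (b + \<xi>)) = u * \<xi>" if "rep s u" "\<xi> \<in> X" for s u \<xi>
    unfolding val_def
  proof (rule some_equality)
    show "\<exists>s' u' \<xi>'. rep s' u' \<and> \<xi>' \<in> X \<and> s + (b + \<xi>) = s' + (b + \<xi>') \<and> u * \<xi> = u' * \<xi>'"
      using that by blast
    fix y assume "\<exists>s' u' \<xi>'. rep s' u' \<and> \<xi>' \<in> X \<and> s + (b + \<xi>) = s' + (b + \<xi>') \<and> y = u' * \<xi>'"
    then obtain s' u' \<xi>' where *: "rep s' u'" "\<xi>' \<in> X" "s + (b + \<xi>) = s' + (b + \<xi>')" "y = u' * \<xi>'" by blast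
    have "s' + \<xi>' = s + \<xi>" using *(3) by (simp add: algebra_simps)
    then show "y = u * \<xi>" unfolding *(4) using * that by (intro unique)
  qed
  have val_0: "val (b + \<xi>) = \<xi>" if "\<xi> \<in> X" for \<xi> using val[OF rep_0 that] by simp
  obtain \<phi> where \<phi>: "bij_betw \<phi> X A"
    using finite_same_card_bij[OF finite_X A(1)] X_card A(2) by auto
  define l where "l v = \<phi> (val v)" for v
  have "l ` all_vertices L N \<nu> K \<subseteq> A"
  proof
    fix a assume "a \<in> l ` all_vertices L N \<nu> K"
    then obtain s v where s: "s \<in> complex_shifts L N \<nu> K" and v: "v \<in> (+) s ` V" "a = l v"
      unfolding all_vertices_def zero_complexes_def using complex_vertices_shift by auto
    then obtain \<xi> where \<xi>: "\<xi> \<in> X" "v = s + (b + \<xi>)" unfolding V_eq by auto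
    obtain u where u: "rep s u" using rep_shift s by blast
    have "u * \<xi> \<in> X" using rep_root[OF u] \<xi>(1) by (rule X_root_mult)
    then show "a \<in> A" using \<phi> by (auto simp: v(2) l_def \<xi>(2) val[OF u \<xi>(1)] bij_betw_def)
  qed
  moreover have "bij_betw l V A"
  proof -
    have "bij_betw (\<lambda>\<xi>. l (b + \<xi>)) X A" using \<phi> by (rule bij_betw_cong[THEN iffD1, rotated]) (simp add: l_def val_0)
    then have "bij_betw (l \<circ> (+) b) X A" by (simp add: o_def)
    moreover have "bij_betw ((+) b) X V" by (simp add: V_eq bij_betw_def)
    ultimately show ?thesis using bij_betw_comp_iff by blast
  qed
  moreover have "\<exists>R\<in>vertex_rotations L N \<nu>. \<forall>v\<in>complex_vertices L N \<nu> K ((+) s ` K). l v = l (R (v - s))"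
    if s: "s \<in> complex_shifts L N \<nu> K" for s
  proof -
    obtain u where u: "rep s u" using rep_shift s by blast
    have root: "u ^ k = 1" using u by (rule rep_root)
    then obtain n where "u = \<omega> ^ n" by (rule root_eq_\<omega>_power)
    then obtain \<alpha> where \<alpha>: "u = cis \<alpha>" by (simp add: Complex.DeMoivre)
    have R: "rotation b \<alpha> (b + \<xi>) = b + u * \<xi>" for \<xi> by (simp add: rotation_def \<alpha>)
    have "rotation b \<alpha> ` V = (+) b ` (*) u ` X" unfolding V_eq image_image R ..
    then have "rotation b \<alpha> \<in> vertex_rotations L N \<nu>"
      unfolding vertex_rotations_def X_root_image[OF root] V_eq[symmetric] by blast
    moreover have "l v = l (rotation b \<alpha> (v - s))" if v: "v \<in> complex_vertices L N \<nu> K ((+) s ` K)" for v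
    proof -
      obtain \<xi> where \<xi>: "\<xi> \<in> X" "v = s + (b + \<xi>)"
        using v unfolding complex_vertices_shift[OF s] V_eq by auto
      have "v - s = b + \<xi>" by (simp add: \<xi>(2))
      then show ?thesis
        unfolding l_def by (simp add: R \<xi>(2) val[OF u \<xi>(1)] val_0[OF X_root_mult[OF root \<xi>(1)]])
    qed
    ultimately show ?thesis by blast
  qed
  ultimately show ?thesis unfolding good_labelling_property_def by blast
qed

lemma labelling_iff_cycle_products:
  assumes "finite A" "card A = k"
  shows "good_labelling_property L N \<nu> K A \<longleftrightarrow>
    (\<forall>xs. index_cycle xs \<longrightarrow> (\<Prod>t<length xs. ratio (xs ! t) (xs ! (Suc t mod length xs))) = 1)"
proof
  assume R: "\<forall>xs. index_cycle xs \<longrightarrow> (\<Prod>t<length xs. ratio (xs ! t) (xs ! (Suc t mod length xs))) = 1"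
  obtain v0 where v0: "v0 \<in> {1..N}" "\<nu> v0 = 0" using ex_zero by blast
  obtain g where "potential g" "g v0 = 1"
    by (rule cycle_products_imp_potential[OF _ v0(1)]) (use R in blast)+
  then show "good_labelling_property L N \<nu> K A"
    using v0 assms by (intro potential_imp_labelling)
qed (use labelling_imp_cycle_products in blast)

end

theorem theorem3p1:
  fixes L :: real and N k :: nat and \<nu> :: "nat \<Rightarrow> complex" and K :: "complex set" and A :: "'a set"
  assumes "simple_nested_fractal L N \<nu> K"
    and "k = card (essential_fixed_points L N \<nu>)"
    and "k \<ge> 3" and "odd k"
    and "finite A" and "card A = k"
  shows "good_labelling_property L N \<nu> K A \<longleftrightarrow>
    (\<forall>\<Delta>s c d. is_cycle L N \<nu> K \<Delta>s \<and>
       c = rotation_count L N \<nu> K ((real k + 1) / real k * pi) \<Delta>s \<and>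
       d = rotation_count L N \<nu> K ((real k - 1) / real k * pi) \<Delta>s \<longrightarrow>
       int k dvd (int c - int d))"
proof -
  interpret odd_nested_fractal L N k \<nu> K
    by unfold_locales (use assms in auto)
  show ?thesis
    unfolding rotation_counts_iff_cycle_products using assms(5,6) by (rule labelling_iff_cycle_products)
qed

end
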